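(* Let $\Upsilon$ be a gain signed graph with gains in $\mathbb{K}$. The map $e\mapsto \mathbf{h}_{\mathbb{P}}(e)$ ($e\in E_\infty$) is an isomorphism from the extended matroid $M_\infty(\Upsilon)$ to the matroid $M(\mathcal{A}_{\mathbb{P}}[\Upsilon])$; it induces a lattice isomorphism $\mathcal{L}(\mathcal{A}_{\mathbb{P}}[\Upsilon])\cong \mathrm{Lat}\,M_\infty(\Upsilon)$ and a semilattice isomorphism $\mathcal{L}(\mathcal{A}[\Upsilon])\cong \mathrm{Lat}^b\,\Upsilon$.
   Context: Let $\mathbb{K}$ be a field of characteristic $\ne2$. A graph $\Gamma=(V,E)$ has vertex set $V=\{v_1,\dots,v_n\}$ and finite edge set $E$; edges are links (two ends at distinct vertices), loops (two ends at one vertex), half edges (one end) or loose edges (no ends); parallel edges allowed. A gain signed graph $\Upsilon=(\Gamma,\sigma,\varphi)$: $\sigma:E\to\{\pm1\}$ (half edges negative, loose edges positive); with an orientation $\tau$ (signs $\tau(v,e)\in\{\pm1\}$ on edge ends, $\tau(v,e)\tau(w,e)=-\sigma(e)$ for a link or loop with ends $v,w$) each edge has gain $\varphi(e)\in\mathbb{K}$, negated on reorientation. Neutral = gain $0$. Walk gain of $W=u_0e_1\cdots e_lu_l$: $\varphi(W)=-\sum_i\varphi(e_i)\sigma(W_{0,i-1})\tau(u_{i-1},e_i)$, $\sigma(W_{0,j})=\prod_{i\le j}\sigma(e_i)$. Ultrawalks may begin with a half edge $e_0$ at $u_0$ and/or end with a half edge $e_{l+1}$ at $u_l$; their gain adds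 $\tau(u_0,e_0)\varphi(e_0)$ and/or $-\varphi(e_{l+1})\sigma(W_{0,l})\tau(u_l,e_{l+1})$ to $\varphi(W_{0,l})$. Circles: connected 2-regular subgraphs, sign = product of edge signs; a negative figure is a negative circle or a half edge. A sign circuit is a positive circle, a loose edge, or a handcuff (two negative figures with exactly one common vertex, or two disjoint negative figures plus a path joining them meeting them only at its ends). Its gain: the edge gain for a loose edge; else $\varphi(W)$ for a circuit walk (once around a positive circle; for a handcuff with figures $C_1,C_2$, connecting path $P$ of length $\ge0$: around $C_1$, along $P$, around $C_2$, back along $P$ if both circles; from half edge $C_1$ along $P$, around $C_2$, back, ending with $C_1$ if $C_1$ half edge and $C_2$ circle; from one half edge along $P$ to the other if both half edges); well defined up to sign; neutral if $0$. $S$ is hyperbalanced if all sign circuits in $S$ are neutral, hyperfrustrated otherwise; sign balanced if no negative circle and no half edge. $b_\Sigma(S)$ = number of sign-balanced connected components of $(V,S)$ (loose edges excluded). $M(\Upsilon)$: matroid on $E$ with rank $n-b_\Sigma(S)+\delta(S)$ ($\delta=0$ if hyperbalanced, $1$ otherwise); $M_\infty(\Upsilon)$: same formula on $E_\infty=E\cup\{e_\infty\}$, $e_\infty$ an extra element treated as a non-neutral loose edge. $\mathrm{Lat}\,M_\infty(\Upsilon)$ is its lattice of flats; $\mathrm{Lat}^b\,\Upsilon$ is the meet-semilattice of hyperbalanced flats of $M(\Upsilon)$. Vectors in $\mathbb{K}^{1+n}$ (basis $\mathbf{e}_0,\dots,\mathbf{e}_n$): $\mathbf{z}(e)=\varphi(e)\mathbf{e}_0+\tau(v_i,e)\mathbf{e}_i+\tau(v_j,e)\mathbf{e}_j$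 for a link or loop with ends $v_i,v_j$ (terms added for a loop), $\varphi(e)\mathbf{e}_0+\tau(v_i,e)\mathbf{e}_i$ for a half edge at $v_i$, $\varphi(e)\mathbf{e}_0$ for a loose edge, $\mathbf{z}(e_\infty)=\mathbf{e}_0$. Arrangements: for $e\in E$ the affine (honorary) hyperplane $\mathbf{h}(e)=\{x\in\mathbb{K}^n: \mathbf{z}(e)\cdot(1,x)=0\}$; e.g. $\tau(v_i,e)x_i+\tau(v_j,e)x_j=-\varphi(e)$ for a link, $\tau(v_i,e)x_i=-\varphi(e)$ for a half edge; for a loose edge it is all of $\mathbb{K}^n$ (degenerate) if $\varphi(e)=0$ and $\emptyset$ (phantom) otherwise. $\mathcal{A}[\Upsilon]=\{\mathbf{h}(e):e\in E\}$ with intersection semilattice $\mathcal{L}(\mathcal{A}[\Upsilon])$ of nonempty intersections of subfamilies (ordered by reverse inclusion). In projective space $\mathbb{P}^n(\mathbb{K})$ with homogeneous coordinates $[y_0,\dots,y_n]$, $\mathbf{h}_{\mathbb{P}}(e)=\{[y]:\mathbf{z}(e)\cdot y=0\}$ for $e\in E_\infty$ (so $\mathbf{h}_{\mathbb{P}}(e_\infty)$ is the infinite hyperplane $h_\infty$, as is the image of any non-neutral loose edge); $\mathcal{A}_{\mathbb{P}}[\Upsilon]$ is the family of these, indexed by $E_\infty$; $\mathcal{L}(\mathcal{A}_{\mathbb{P}}[\Upsilon])$ is the lattice of all intersections of subfamilies; $M(\mathcal{A}_{\mathbb{P}}[\Upsilon])$ is the matroid on this family with rank of a subfamily equal to the codimension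 of its intersection. *)

theory Defs
  imports "HOL-Analysis.Analysis" "HOL-Algebra.Lattice"
begin

section \<open>Gain signed graphs\<close>

text \<open>
  The vertex set is the whole finite type \<open>'v\<close>, so \<open>n = CARD('v)\<close>.  \<open>ends e\<close> lists the vertices at
  the ends of \<open>e\<close>: two entries for a link (distinct) or a loop (equal), one for a half edge, none
  for a loose edge.  The order of the entries carries no meaning; it only names the edge ends, so
  that the two ends of a loop have separate orientation signs.  \<open>orient e i\<close> is the sign \<open>\<tau>\<close> of the
  end \<open>i < length (ends e)\<close>, and \<open>gain e\<close> is the gain of \<open>e\<close> in the orientation \<open>\<tau>\<close>.
\<close>

record ('v, 'e, 'k) gsgraph =
  edges :: "'e set"
  ends :: "'e \<Rightarrow> 'v list"
  esign :: "'e \<Rightarrow> int"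
  orient :: "'e \<Rightarrow> nat \<Rightarrow> int"
  gain :: "'e \<Rightarrow> 'k"

definition gain_signed_graph :: "('v, 'e, 'k) gsgraph \<Rightarrow> bool" where
  "gain_signed_graph G \<longleftrightarrow> finite (edges G) \<and>
    (\<forall>e\<in>edges G.
      length (ends G e) \<le> 2 \<and>
      esign G e \<in> {1, -1} \<and>
      (\<forall>i<length (ends G e). orient G e i \<in> {1, -1}) \<and>
      (length (ends G e) = 0 \<longrightarrow> esign G e = 1) \<and>
      (length (ends G e) = 1 \<longrightarrow> esign G e = -1) \<and>
      (length (ends G e) = 2 \<longrightarrow> orient G e 0 * orient G e 1 = - esign G e))"

definition loose_edge :: "('v, 'e, 'k) gsgraph \<Rightarrow> 'e \<Rightarrow> bool" where
  "loose_edge G e \<longleftrightarrow> e \<in> edges G \<and> length (ends G e) = 0"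

definition half_edge :: "('v, 'e, 'k) gsgraph \<Rightarrow> 'e \<Rightarrow> bool" where
  "half_edge G e \<longleftrightarrow> e \<in> edges G \<and> length (ends G e) = 1"

text \<open>The vertex set of the subgraph formed by a set of edges.\<close>

definition verts :: "('v, 'e, 'k) gsgraph \<Rightarrow> 'e set \<Rightarrow> 'v set" where
  "verts G S = (\<Union>e\<in>S. set (ends G e))"


subsection \<open>Walks and their gains\<close>

text \<open>
  A step \<open>(e, i)\<close> of a walk traverses the link or loop \<open>e\<close>, leaving through its end \<open>i\<close> and arriving
  through its end \<open>1 - i\<close>; thus \<open>\<tau>(u\<^sub>i\<^sub>-\<^sub>1, e\<^sub>i)\<close> is the orientation sign of the end through which
  the walk leaves, also when \<open>e\<^sub>i\<close> is a loop.
\<close>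

fun walk :: "('v, 'e, 'k) gsgraph \<Rightarrow> 'v \<Rightarrow> ('e \<times> nat) list \<Rightarrow> 'v \<Rightarrow> bool" where
  "walk G u [] v \<longleftrightarrow> u = v"
| "walk G u ((e, i) # W) v \<longleftrightarrow>
     e \<in> edges G \<and> length (ends G e) = 2 \<and> i < 2 \<and> ends G e ! i = u \<and>
     walk G (ends G e ! (1 - i)) W v"

definition walk_edges :: "('e \<times> nat) list \<Rightarrow> 'e set" where
  "walk_edges W = fst ` set W"

definition walk_verts :: "('v, 'e, 'k) gsgraph \<Rightarrow> 'v \<Rightarrow> ('e \<times> nat) list \<Rightarrow> 'v list" where
  "walk_verts G u W = u # map (\<lambda>(e, i). ends G e ! (1 - i)) W"

definition rev_walk :: "('e \<times> nat) list \<Rightarrow> ('e \<times> nat) list" where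
  "rev_walk W = rev (map (\<lambda>(e, i). (e, 1 - i)) W)"

text \<open>A path; the case \<open>P = []\<close>, \<open>u = v\<close> of length zero is allowed.\<close>

definition path_between :: "('v, 'e, 'k) gsgraph \<Rightarrow> 'v \<Rightarrow> ('e \<times> nat) list \<Rightarrow> 'v \<Rightarrow> bool" where
  "path_between G u P v \<longleftrightarrow> walk G u P v \<and> distinct (walk_verts G u P)"

definition walk_sign :: "('v, 'e, 'k) gsgraph \<Rightarrow> ('e \<times> nat) list \<Rightarrow> int" where
  "walk_sign G W = (\<Prod>(e, i)\<leftarrow>W. esign G e)"

definition walk_gain :: "('v, 'e, 'k::comm_ring_1) gsgraph \<Rightarrow> ('e \<times> nat) list \<Rightarrow> 'k" where
  "walk_gain G W = - (\<Sum>j<length W. gain G (fst (W ! j)) * of_int (walk_sign G (take j W)) *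
                                    of_int (orient G (fst (W ! j)) (snd (W ! j))))"

text \<open>The gain of an ultrawalk, which may start with a half edge \<open>a\<close> and may end with a half edge \<open>b\<close>.\<close>

definition ultrawalk_gain ::
    "('v, 'e, 'k::comm_ring_1) gsgraph \<Rightarrow> 'e option \<Rightarrow> ('e \<times> nat) list \<Rightarrow> 'e option \<Rightarrow> 'k" where
  "ultrawalk_gain G a W b =
     (case a of None \<Rightarrow> 0 | Some h \<Rightarrow> of_int (orient G h 0) * gain G h) + walk_gain G W +
     (case b of None \<Rightarrow> 0 | Some h \<Rightarrow> - gain G h * of_int (walk_sign G W) * of_int (orient G h 0))"


subsection \<open>Circles, sign circuits and balance\<close>

definition connected_in :: "('v, 'e, 'k) gsgraph \<Rightarrow> 'e set \<Rightarrow> 'v \<Rightarrow> 'v \<Rightarrow> bool" where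
  "connected_in G S u v \<longleftrightarrow> (\<exists>W. walk G u W v \<and> walk_edges W \<subseteq> S)"

text \<open>A loop contributes two to the degree of its vertex.\<close>

definition degree_in :: "('v, 'e, 'k) gsgraph \<Rightarrow> 'e set \<Rightarrow> 'v \<Rightarrow> nat" where
  "degree_in G S v = (\<Sum>e\<in>S. count_list (ends G e) v)"

definition circle :: "('v, 'e, 'k) gsgraph \<Rightarrow> 'e set \<Rightarrow> bool" where
  "circle G C \<longleftrightarrow> C \<subseteq> edges G \<and> C \<noteq> {} \<and> (\<forall>e\<in>C. length (ends G e) = 2) \<and>
     (\<forall>v\<in>verts G C. degree_in G C v = 2) \<and>
     (\<forall>u\<in>verts G C. \<forall>v\<in>verts G C. connected_in G C u v)"

definition positive_circle :: "('v, 'e, 'k) gsgraph \<Rightarrow> 'e set \<Rightarrow> bool" where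
  "positive_circle G C \<longleftrightarrow> circle G C \<and> (\<Prod>e\<in>C. esign G e) = 1"

definition negative_circle :: "('v, 'e, 'k) gsgraph \<Rightarrow> 'e set \<Rightarrow> bool" where
  "negative_circle G C \<longleftrightarrow> circle G C \<and> (\<Prod>e\<in>C. esign G e) = -1"

definition negative_figure :: "('v, 'e, 'k) gsgraph \<Rightarrow> 'e set \<Rightarrow> bool" where
  "negative_figure G C \<longleftrightarrow> negative_circle G C \<or> (\<exists>h. half_edge G h \<and> C = {h})"

text \<open>
  Two negative figures \<open>C\<^sub>1\<close>, \<open>C\<^sub>2\<close> and a connecting path \<open>P\<close> from \<open>u \<in> C\<^sub>1\<close> to \<open>v \<in> C\<^sub>2\<close>.  For
  \<open>P = []\<close> the figures have exactly the vertex \<open>u = v\<close> in common; otherwise they are disjoint.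
  The condition \<open>C\<^sub>1 \<noteq> C\<^sub>2\<close> matters for a single half edge or negative loop.
\<close>

definition handcuff ::
    "('v, 'e, 'k) gsgraph \<Rightarrow> 'e set \<Rightarrow> 'v \<Rightarrow> ('e \<times> nat) list \<Rightarrow> 'v \<Rightarrow> 'e set \<Rightarrow> bool" where
  "handcuff G C\<^sub>1 u P v C\<^sub>2 \<longleftrightarrow>
     negative_figure G C\<^sub>1 \<and> negative_figure G C\<^sub>2 \<and> C\<^sub>1 \<noteq> C\<^sub>2 \<and> path_between G u P v \<and>
     verts G C\<^sub>1 \<inter> set (walk_verts G u P) = {u} \<and>
     verts G C\<^sub>2 \<inter> set (walk_verts G u P) = {v} \<and>
     verts G C\<^sub>1 \<inter> verts G C\<^sub>2 = (if P = [] then {u} else {})"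

definition sign_circuit :: "('v, 'e, 'k) gsgraph \<Rightarrow> 'e set \<Rightarrow> bool" where
  "sign_circuit G C \<longleftrightarrow> positive_circle G C \<or> (\<exists>e. loose_edge G e \<and> C = {e}) \<or>
     (\<exists>C\<^sub>1 u P v C\<^sub>2. handcuff G C\<^sub>1 u P v C\<^sub>2 \<and> C = C\<^sub>1 \<union> walk_edges P \<union> C\<^sub>2)"

text \<open>A closed walk from \<open>u\<close> once around the circle \<open>C\<close>, in either direction.\<close>

definition around :: "('v, 'e, 'k) gsgraph \<Rightarrow> 'e set \<Rightarrow> 'v \<Rightarrow> ('e \<times> nat) list \<Rightarrow> bool" where
  "around G C u W \<longleftrightarrow> walk G u W u \<and> distinct (map fst W) \<and> walk_edges W = C"

text \<open>
  \<open>circuit_gain G C g\<close>: some circuit walk of the sign circuit \<open>C\<close> has gain \<open>g\<close>.  Every sign circuit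
  has a circuit walk, and its gain is determined up to sign.
\<close>

inductive circuit_gain :: "('v, 'e, 'k::comm_ring_1) gsgraph \<Rightarrow> 'e set \<Rightarrow> 'k \<Rightarrow> bool"
  for G :: "('v, 'e, 'k) gsgraph" where
  loose: "loose_edge G e \<Longrightarrow> circuit_gain G {e} (gain G e)"
| positive_circle: "positive_circle G C \<Longrightarrow> around G C u W \<Longrightarrow> circuit_gain G C (walk_gain G W)"
| circle_circle:
    "handcuff G C\<^sub>1 u P v C\<^sub>2 \<Longrightarrow> negative_circle G C\<^sub>1 \<Longrightarrow> negative_circle G C\<^sub>2 \<Longrightarrow>
     around G C\<^sub>1 u W\<^sub>1 \<Longrightarrow> around G C\<^sub>2 v W\<^sub>2 \<Longrightarrow>
     circuit_gain G (C\<^sub>1 \<union> walk_edges P \<union> C\<^sub>2) (walk_gain G (W\<^sub>1 @ P @ W\<^sub>2 @ rev_walk P))"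
| half_circle:
    "handcuff G {h} u P v C\<^sub>2 \<Longrightarrow> half_edge G h \<Longrightarrow> negative_circle G C\<^sub>2 \<Longrightarrow> around G C\<^sub>2 v W\<^sub>2 \<Longrightarrow>
     circuit_gain G ({h} \<union> walk_edges P \<union> C\<^sub>2)
       (ultrawalk_gain G (Some h) (P @ W\<^sub>2 @ rev_walk P) (Some h))"
| half_half:
    "handcuff G {h} u P v {h'} \<Longrightarrow> half_edge G h \<Longrightarrow> half_edge G h' \<Longrightarrow>
     circuit_gain G ({h} \<union> walk_edges P \<union> {h'}) (ultrawalk_gain G (Some h) P (Some h'))"

definition neutral_circuit :: "('v, 'e, 'k::comm_ring_1) gsgraph \<Rightarrow> 'e set \<Rightarrow> bool" where
  "neutral_circuit G C \<longleftrightarrow> (\<forall>g. circuit_gain G C g \<longrightarrow> g = 0)"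

definition hyperbalanced :: "('v, 'e, 'k::comm_ring_1) gsgraph \<Rightarrow> 'e set \<Rightarrow> bool" where
  "hyperbalanced G S \<longleftrightarrow> (\<forall>C\<subseteq>S. sign_circuit G C \<longrightarrow> neutral_circuit G C)"

definition sign_balanced :: "('v, 'e, 'k) gsgraph \<Rightarrow> 'e set \<Rightarrow> bool" where
  "sign_balanced G S \<longleftrightarrow> (\<forall>C\<subseteq>S. \<not> negative_circle G C) \<and> (\<forall>e\<in>S. \<not> half_edge G e)"

text \<open>The connected components of \<open>(V, S)\<close>, as vertex sets; isolated vertices are components.\<close>

definition components_of :: "('v, 'e, 'k) gsgraph \<Rightarrow> 'e set \<Rightarrow> 'v set set" where
  "components_of G S = UNIV // {(u, v). connected_in G S u v}"

definition component_edges :: "('v, 'e, 'k) gsgraph \<Rightarrow> 'e set \<Rightarrow> 'v set \<Rightarrow> 'e set" where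
  "component_edges G S X = {e \<in> S. \<not> loose_edge G e \<and> set (ends G e) \<subseteq> X}"

definition balanced_components :: "('v, 'e, 'k) gsgraph \<Rightarrow> 'e set \<Rightarrow> nat" where
  "balanced_components G S =
     card {X \<in> components_of G S. sign_balanced G (component_edges G S X)}"


section \<open>Matroids and lattices\<close>

record 'a rank_matroid =
  ground :: "'a set"
  rk :: "'a set \<Rightarrow> nat"

definition matroid :: "'a rank_matroid \<Rightarrow> bool" where
  "matroid M \<longleftrightarrow> finite (ground M) \<and>
     (\<forall>S\<subseteq>ground M. rk M S \<le> card S) \<and>
     (\<forall>S T. S \<subseteq> T \<longrightarrow> T \<subseteq> ground M \<longrightarrow> rk M S \<le> rk M T) \<and>
     (\<forall>S\<subseteq>ground M. \<forall>T\<subseteq>ground M. rk M (S \<union> T) + rk M (S \<inter> T) \<le> rk M S + rk M T)"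

definition matroid_isomorphism :: "'a rank_matroid \<Rightarrow> 'b rank_matroid \<Rightarrow> ('a \<Rightarrow> 'b) \<Rightarrow> bool" where
  "matroid_isomorphism M N f \<longleftrightarrow> matroid M \<and> matroid N \<and>
     bij_betw f (ground M) (ground N) \<and> (\<forall>S\<subseteq>ground M. rk N (f ` S) = rk M S)"

definition flats :: "'a rank_matroid \<Rightarrow> 'a set set" where
  "flats M = {F. F \<subseteq> ground M \<and> (\<forall>e\<in>ground M - F. rk M F < rk M (insert e F))}"

text \<open>A family of sets, ordered by inclusion and by reverse inclusion.\<close>

definition inclusion_order :: "'a set set \<Rightarrow> 'a set gorder" where
  "inclusion_order L = \<lparr>carrier = L, eq = (=), le = (\<subseteq>)\<rparr>"

definition reverse_inclusion_order :: "'a set set \<Rightarrow> 'a set gorder" where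
  "reverse_inclusion_order L = \<lparr>carrier = L, eq = (=), le = (\<supseteq>)\<rparr>"

definition lattice_isomorphism :: "'a gorder \<Rightarrow> 'b gorder \<Rightarrow> ('a \<Rightarrow> 'b) \<Rightarrow> bool" where
  "lattice_isomorphism X Y f \<longleftrightarrow>
     bij_betw f (carrier X) (carrier Y) \<and> join_pres X Y f \<and> meet_pres X Y f"

text \<open>\<^const>\<open>meet_pres\<close> cannot be used here, since it requires both orders to be lattices.\<close>

definition semilattice_isomorphism :: "'a gorder \<Rightarrow> 'b gorder \<Rightarrow> ('a \<Rightarrow> 'b) \<Rightarrow> bool" where
  "semilattice_isomorphism X Y f \<longleftrightarrow>
     lower_semilattice X \<and> lower_semilattice Y \<and> bij_betw f (carrier X) (carrier Y) \<and>
     (\<forall>x\<in>carrier X. \<forall>y\<in>carrier X. f (x \<sqinter>\<^bsub>X\<^esub> y) = f x \<sqinter>\<^bsub>Y\<^esub> f y)"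


section \<open>The matroids of a gain signed graph\<close>

definition gain_matroid :: "('v::finite, 'e, 'k::comm_ring_1) gsgraph \<Rightarrow> 'e rank_matroid" where
  "gain_matroid G = \<lparr>ground = edges G,
     rk = (\<lambda>S. CARD('v) - balanced_components G S + (if hyperbalanced G S then 0 else 1))\<rparr>"

text \<open>Adjoining \<open>e\<^sub>\<infinity> = None\<close> as a loose edge of gain \<open>1\<close>.\<close>

definition extend :: "('v, 'e, 'k::comm_ring_1) gsgraph \<Rightarrow> ('v, 'e option, 'k) gsgraph" where
  "extend G = \<lparr>edges = insert None (Some ` edges G),
     ends = case_option [] (ends G),
     esign = case_option 1 (esign G),
     orient = case_option (\<lambda>_. 1) (orient G),
     gain = case_option 1 (gain G)\<rparr>"

definition extended_matroid ::
    "('v::finite, 'e, 'k::comm_ring_1) gsgraph \<Rightarrow> 'e option rank_matroid" where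
  "extended_matroid G = gain_matroid (extend G)"

definition Lat_extended :: "('v::finite, 'e, 'k::comm_ring_1) gsgraph \<Rightarrow> 'e option set gorder" where
  "Lat_extended G = inclusion_order (flats (extended_matroid G))"

definition Lat_balanced :: "('v::finite, 'e, 'k::comm_ring_1) gsgraph \<Rightarrow> 'e set gorder" where
  "Lat_balanced G = inclusion_order {F \<in> flats (gain_matroid G). hyperbalanced G F}"


section \<open>The arrangements of a gain signed graph\<close>

text \<open>
  Coordinates of \<open>K\<^bsup>1+n\<^esup>\<close> are indexed by \<open>'v option\<close>, the coordinate \<open>0\<close> being \<^term>\<open>None\<close>.  For
  \<open>e\<^sub>\<infinity>\<close>, a loose edge of gain \<open>1\<close> in \<^term>\<open>extend G\<close>, this gives the basis vector \<open>\<^bold>e\<^sub>0\<close>.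
\<close>

definition edge_vector :: "('v::finite, 'e, 'k::field) gsgraph \<Rightarrow> 'e \<Rightarrow> 'k ^ 'v option" where
  "edge_vector G e = gain G e *s axis None 1 +
     (\<Sum>i<length (ends G e). of_int (orient G e i) *s axis (Some (ends G e ! i)) 1)"

definition homogenize :: "'k::field ^ 'v::finite \<Rightarrow> 'k ^ 'v option" where
  "homogenize x = (\<chi> i. case i of None \<Rightarrow> 1 | Some v \<Rightarrow> x $ v)"

definition affine_hyperplane :: "('v::finite, 'e, 'k::field) gsgraph \<Rightarrow> 'e \<Rightarrow> ('k ^ 'v) set" where
  "affine_hyperplane G e = {x. scalar_product (edge_vector G e) (homogenize x) = 0}"

definition L_affine :: "('v::finite, 'e, 'k::field) gsgraph \<Rightarrow> ('k ^ 'v) set gorder" where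
  "L_affine G = reverse_inclusion_order
     {t. t \<noteq> {} \<and> (\<exists>S\<subseteq>edges G. t = (\<Inter>e\<in>S. affine_hyperplane G e))}"

text \<open>A point \<open>[y]\<close> of projective space is the line spanned by \<open>y \<noteq> 0\<close>.\<close>

definition proj_point :: "'k::field ^ 'm::finite \<Rightarrow> ('k ^ 'm) set" where
  "proj_point y = vec.span {y}"

definition proj_space :: "('k::field ^ 'm::finite) set set" where
  "proj_space = {proj_point y | y. y \<noteq> 0}"

text \<open>
  For projective subspaces, codimension in projective space is codimension of the corresponding
  linear subspaces; the empty subspace of \<open>\<^bold>P\<^sup>n\<close> has codimension \<open>n + 1\<close>.
\<close>

definition proj_codim :: "('k::field ^ 'm::finite) set set \<Rightarrow> nat" where
  "proj_codim X = CARD('m) - vec.dim (\<Union>X)"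

definition proj_hyperplane ::
    "('v::finite, 'e, 'k::field) gsgraph \<Rightarrow> 'e \<Rightarrow> ('k ^ 'v option) set set" where
  "proj_hyperplane G e = {proj_point y | y. y \<noteq> 0 \<and> scalar_product (edge_vector G e) y = 0}"

text \<open>
  In a family of hyperplanes, indexed by \<open>E\<^sub>\<infinity>\<close>, the same hyperplane may occur repeatedly; its members
  are therefore represented as pairs of an index and a hyperplane.
\<close>

definition proj_member :: "('v::finite, 'e, 'k::field) gsgraph \<Rightarrow> 'e option \<Rightarrow>
    'e option \<times> ('k ^ 'v option) set set" where
  "proj_member G e = (e, proj_hyperplane (extend G) e)"

definition proj_arrangement :: "('v::finite, 'e, 'k::field) gsgraph \<Rightarrow>
    ('e option \<times> ('k ^ 'v option) set set) set" where
  "proj_arrangement G = proj_member G ` edges (extend G)"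

definition proj_intersection ::
    "('i \<times> ('k::field ^ 'm::finite) set set) set \<Rightarrow> ('k ^ 'm) set set" where
  "proj_intersection F = proj_space \<inter> (\<Inter>(i, h)\<in>F. h)"

definition arrangement_matroid :: "('v::finite, 'e, 'k::field) gsgraph \<Rightarrow>
    ('e option \<times> ('k ^ 'v option) set set) rank_matroid" where
  "arrangement_matroid G =
     \<lparr>ground = proj_arrangement G, rk = (\<lambda>F. proj_codim (proj_intersection F))\<rparr>"

definition L_projective ::
    "('v::finite, 'e, 'k::field) gsgraph \<Rightarrow> ('k ^ 'v option) set set gorder" where
  "L_projective G = reverse_inclusion_order {proj_intersection F | F. F \<subseteq> proj_arrangement G}"

end

(*
  The solution space W(S) = {y : z(e).y = 0 for all e in S} has dimension b(S) + 1 if S is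
  hyperbalanced and b(S) otherwise; given this, all three isomorphisms are linear algebra over K.

  The solutions with y_0 = 0 have a basis of one +1/-1 switching function for each balanced component;
  a vertex function that satisfies all homogeneous equations vanishes on the unbalanced components,
  since 2 is invertible. Solutions with y_0 = 1 exist exactly if S is hyperbalanced. If one exists, the
  gain of a walk telescopes to x_u - sigma x_v, so circuits are neutral. Conversely take an
  inclusion-minimal S without such a solution. Every proper subset has one, so telescoping along a
  sign circuit in S would give the missing equation of one of its edges; hence S contains no sign
  circuit. Minimality also shows that every edge depends on the others, so each edge end meets another
  edge. Starting from a half edge or a negative circle N and following a longest path that leaves N, the
  next edge closes up to a handcuff, or returns to N and creates a theta graph, which contains a positive
  circle: a contradiction.
*)
theory Submission
  imports Defs
begin

section \<open>Walks\<close>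

text \<open>Circles are defined by degrees and connectivity, whereas gains belong to walks, yet no
  circle is ever unrolled into a walk. Circles that have to be found are built as closed walks and
  then shown to be circles; the sign of a given circle is computed from its degrees; the circuit
  walks of a given sign circuit come with \<open>circuit_gain\<close>.

  In a minimal unsolvable set the failure of one equation is measured by its defect
  \<open>edge_eval G 1 x p\<close>. The edge \<open>p\<close> is placed on a negative figure at the
  start of the circuit walk, where the coefficient of the defect is simplest: a sign, or twice a
  sign when a half edge is joined to a circle, which is a second use of the invertibility of 2.

  The rank formula is not known in advance to define a matroid. Rank and dimension of the solution
  space add up to n + 1, so the matroid axioms, the flats and their order are all read off from
  solution spaces. The extended graph is itself a gain signed graph, so the results apply to it
  directly.\<close>

lemma walk_append: "walk G u (P @ Q) v \<longleftrightarrow> (\<exists>w. walk G u P w \<and> walk G w Q v)"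
  by (induction P arbitrary: u) auto

lemma walk_edges_simps [simp]:
  "walk_edges [] = {}" "walk_edges (s # W) = insert (fst s) (walk_edges W)"
  "walk_edges (P @ Q) = walk_edges P \<union> walk_edges Q"
  by (auto simp: walk_edges_def)

lemma walk_sign_simps [simp]:
  "walk_sign G [] = 1" "walk_sign G (s # W) = esign G (fst s) * walk_sign G W"
  "walk_sign G (P @ Q) = walk_sign G P * walk_sign G Q"
  by (simp_all add: walk_sign_def case_prod_unfold)

lemma walk_verts_simps [simp]:
  "walk_verts G u [] = [u]"
  "walk_verts G u ((e, i) # W) = u # walk_verts G (ends G e ! (1 - i)) W"
  by (simp_all add: walk_verts_def)

text \<open>For a closed walk this list omits the repeated base vertex, so its distinctness can
  express that the walk is simple.\<close>

definition walk_starts :: "('v, 'e, 'k) gsgraph \<Rightarrow> ('e \<times> nat) list \<Rightarrow> 'v list" where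
  "walk_starts G W = map (\<lambda>(e, i). ends G e ! i) W"

lemma walk_starts_simps [simp]:
  "walk_starts G [] = []" "walk_starts G ((e, i) # W) = (ends G e ! i) # walk_starts G W"
  "walk_starts G (P @ Q) = walk_starts G P @ walk_starts G Q"
  by (simp_all add: walk_starts_def)

lemma walk_verts_eq_starts: "walk G u W v \<Longrightarrow> walk_verts G u W = walk_starts G W @ [v]"
  by (induction W arbitrary: u) auto

lemma walk_verts_append:
  "walk G u P w \<Longrightarrow> walk_verts G u (P @ Q) = walk_starts G P @ walk_verts G w Q"
  by (induction P arbitrary: u) auto

lemma walk_verts_nonempty: "u \<in> set (walk_verts G u W)"
  by (simp add: walk_verts_def)

lemma walk_end_in_verts: "walk G u W v \<Longrightarrow> v \<in> set (walk_verts G u W)"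
  by (simp add: walk_verts_eq_starts)

lemma walk_split:
  assumes "walk G u W v" "x \<in> set (walk_verts G u W)"
  shows "\<exists>A B. W = A @ B \<and> walk G u A x \<and> walk G x B v"
  using assms
proof (induction W arbitrary: u)
  case (Cons s W)
  obtain e i where s: "s = (e, i)" by fastforce
  show ?case
  proof (cases "x = u")
    case True
    then have "s # W = [] @ (s # W)" "walk G u [] x" "walk G x (s # W) v"
      using Cons.prems by auto
    then show ?thesis by blast
  next
    case False
    have "walk G (ends G e ! (1 - i)) W v" "x \<in> set (walk_verts G (ends G e ! (1 - i)) W)"
      using Cons.prems s False by auto
    from Cons.IH[OF this] obtain A B
      where "W = A @ B" "walk G (ends G e ! (1 - i)) A x" "walk G x B v" by blast
    then have "s # W = (s # A) @ B" "walk G u (s # A) x" "walk G x B v"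
      using Cons.prems s by auto
    then show ?thesis by blast
  qed
qed auto

lemma walk_in_edges: "walk G u W v \<Longrightarrow> walk_edges W \<subseteq> edges G"
  by (induction W arbitrary: u) fastforce+

lemma walk_edges_length_2: "walk G u W v \<Longrightarrow> e \<in> walk_edges W \<Longrightarrow> length (ends G e) = 2"
  by (induction W arbitrary: u) auto

lemma walk_index_less: "walk G u W v \<Longrightarrow> (e, i) \<in> set W \<Longrightarrow> i < 2"
  by (induction W arbitrary: u) auto

lemma set_two_indexed: "length xs = 2 \<Longrightarrow> i < 2 \<Longrightarrow> set xs = {xs ! i, xs ! (1 - i)}"
  by (auto simp: length_Suc_conv numeral_2_eq_2 less_Suc_eq)

lemma walk_ends_in_verts:
  "walk G u W v \<Longrightarrow> e \<in> walk_edges W \<Longrightarrow> set (ends G e) \<subseteq> set (walk_verts G u W)"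
proof (induction W arbitrary: u)
  case (Cons s W)
  obtain f i where s: "s = (f, i)" by fastforce
  have w: "walk G (ends G f ! (1 - i)) W v" "length (ends G f) = 2" "i < 2" "ends G f ! i = u"
    using Cons.prems s by auto
  show ?case
  proof (cases "e = f")
    case True
    then show ?thesis using w set_two_indexed[OF w(2,3)] walk_verts_nonempty[of _ G W] s by auto
  next
    case False
    then show ?thesis using Cons w s by auto
  qed
qed auto

lemma rev_walk_simps [simp]:
  "rev_walk [] = []" "rev_walk ((e, i) # W) = rev_walk W @ [(e, 1 - i)]"
  by (simp_all add: rev_walk_def)

lemma walk_rev: "walk G u W v \<Longrightarrow> walk G v (rev_walk W) u"
proof (induction W arbitrary: u)
  case (Cons s W)
  obtain e i where s: "s = (e, i)" by fastforce
  with Cons have "i < 2" "walk G v (rev_walk W) (ends G e ! (1 - i))" by auto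
  then show ?case using Cons.prems s
    by (auto simp: walk_append less_2_cases_iff)
qed auto

lemma walk_edges_rev [simp]: "walk_edges (rev_walk W) = walk_edges W"
  by (induction W) auto

lemma map_fst_rev_walk [simp]: "map fst (rev_walk W) = rev (map fst W)"
  by (induction W) auto

lemma walk_sign_rev [simp]: "walk_sign G (rev_walk W) = walk_sign G W"
  by (induction W) auto

lemma walk_starts_rev:
  "walk G u W v \<Longrightarrow> walk_starts G (rev_walk W) = rev (tl (walk_verts G u W))"
proof (induction W arbitrary: u)
  case (Cons s W)
  obtain e i where s: "s = (e, i)" by fastforce
  with Cons have "walk_starts G (rev_walk W) = rev (tl (walk_verts G (ends G e ! (1 - i)) W))" by auto
  then show ?case using s by (simp add: walk_verts_def)
qed auto

text \<open>A repetition of the first edge would bring its end \<open>u\<close> back among the later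
  vertices.\<close>

lemma path_distinct_edges:
  assumes "walk G u W v" "distinct (walk_verts G u W)"
  shows "distinct (map fst W)"
  using assms
proof (induction W arbitrary: u)
  case (Cons s W)
  obtain e i where s: "s = (e, i)" by fastforce
  have w: "walk G (ends G e ! (1 - i)) W v" "length (ends G e) = 2" "i < 2" "ends G e ! i = u"
    "u \<notin> set (walk_verts G (ends G e ! (1 - i)) W)" "distinct (walk_verts G (ends G e ! (1 - i)) W)"
    using Cons.prems s by auto
  have "e \<notin> walk_edges W"
    using walk_ends_in_verts[OF w(1)] w set_two_indexed[OF w(2,3)] by blast
  then show ?case using Cons.IH[OF w(1,6)] s by (auto simp: walk_edges_def)
qed auto

lemma shortcut_path:
  assumes "walk G u W v"
  shows "\<exists>P. path_between G u P v \<and> walk_edges P \<subseteq> walk_edges W"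
  using assms
proof (induction W arbitrary: u)
  case Nil
  then show ?case by (intro exI[of _ "[]"]) (auto simp: path_between_def)
next
  case (Cons s W)
  obtain e i where s: "s = (e, i)" by fastforce
  let ?w = "ends G e ! (1 - i)"
  have "walk G ?w W v" using Cons.prems s by auto
  from Cons.IH[OF this] obtain P
    where P: "path_between G ?w P v" "walk_edges P \<subseteq> walk_edges W" by blast
  show ?case
  proof (cases "u \<in> set (walk_verts G ?w P)")
    \<comment> \<open>The new start already lies on the path found so far; the part after that
      occurrence is itself a path from \<open>u\<close>.\<close>
    case True
    then obtain A B where AB: "P = A @ B" "walk G ?w A u" "walk G u B v"
      using walk_split[of G ?w P v u] P by (auto simp: path_between_def)
    have "path_between G u B v"
      using P AB walk_verts_append[OF AB(2), of B] by (auto simp: path_between_def)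
    then show ?thesis using P AB by auto
  next
    case False
    then have "path_between G u (s # P) v" using P Cons.prems s by (auto simp: path_between_def)
    moreover have "walk_edges (s # P) \<subseteq> walk_edges (s # W)" using P by auto
    ultimately show ?thesis by blast
  qed
qed

section \<open>Simple cycles as closed walks\<close>

text \<open>Distinct starts alone would admit running along a link and straight back; distinct edges
  exclude this. A loop is the case of length one.\<close>

definition simple_cycle :: "('v, 'e, 'k) gsgraph \<Rightarrow> 'v \<Rightarrow> ('e \<times> nat) list \<Rightarrow> bool" where
  "simple_cycle G u W \<longleftrightarrow>
     walk G u W u \<and> W \<noteq> [] \<and> distinct (walk_starts G W) \<and> distinct (map fst W)"

lemma count_ends_step:
  assumes "length (ends G e) = 2" "i < 2"
  shows "count_list (ends G e) x = count_list [ends G e ! i] x + count_list [ends G e ! (1 - i)] x"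
proof -
  obtain a b where "ends G e = [a, b]"
    using assms by (auto simp: length_Suc_conv numeral_2_eq_2)
  moreover have "i = 0 \<or> i = 1" using assms(2) by auto
  ultimately show ?thesis by (elim disjE) simp_all
qed

text \<open>Each vertex occurrence on a walk accounts for two edge ends, except at the two ends of the walk.\<close>

lemma walk_degree:
  assumes "walk G u W v"
  shows "(\<Sum>e\<leftarrow>map fst W. count_list (ends G e) x) + count_list [u] x + count_list [v] x =
    2 * count_list (walk_verts G u W) x"
  using assms
proof (induction W arbitrary: u)
  case (Cons s W)
  obtain e i where s: "s = (e, i)" by fastforce
  have w: "walk G (ends G e ! (1 - i)) W v" "length (ends G e) = 2" "i < 2" "ends G e ! i = u"
    using Cons.prems s by auto
  show ?case using Cons.IH[OF w(1)] count_ends_step[OF w(2,3), of x] w(4) s by auto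
qed auto

lemma simple_cycle_verts:
  assumes "simple_cycle G u W"
  shows "verts G (walk_edges W) = set (walk_starts G W)" "u \<in> set (walk_starts G W)"
    "set (walk_verts G u W) = set (walk_starts G W)"
proof -
  have w: "walk G u W u" "W \<noteq> []" using assms by (auto simp: simple_cycle_def)
  then show u: "u \<in> set (walk_starts G W)"
    by (cases W) auto
  show eq: "set (walk_verts G u W) = set (walk_starts G W)"
    using walk_verts_eq_starts[OF w(1)] u by auto
  have "set (walk_starts G W) \<subseteq> verts G (walk_edges W)"
  proof
    fix x assume "x \<in> set (walk_starts G W)"
    then obtain e i where ei: "(e, i) \<in> set W" "x = ends G e ! i"
      by (auto simp: walk_starts_def)
    then have "e \<in> walk_edges W" by (force simp: walk_edges_def)
    moreover have "i < 2" using walk_index_less[OF w(1) ei(1)] .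
    ultimately show "x \<in> verts G (walk_edges W)"
      using walk_edges_length_2[OF w(1)] ei(2) unfolding verts_def by force
  qed
  then show "verts G (walk_edges W) = set (walk_starts G W)"
    using walk_ends_in_verts[OF w(1)] eq unfolding verts_def by blast
qed

text \<open>Appending the base vertex to the starts accounts exactly for the two end terms in
  \<open>walk_degree\<close>. Each vertex occurs once among the starts and so has degree
  two.\<close>

lemma simple_cycle_circle:
  assumes "simple_cycle G u W"
  shows "circle G (walk_edges W)"
proof -
  have w: "walk G u W u" "W \<noteq> []" "distinct (walk_starts G W)" "distinct (map fst W)"
    using assms by (auto simp: simple_cycle_def)
  have deg: "degree_in G (walk_edges W) x = 2" if "x \<in> set (walk_starts G W)" for x
  proof -
    have "degree_in G (walk_edges W) x = (\<Sum>e\<leftarrow>map fst W. count_list (ends G e) x)"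
      using sum_list_distinct_conv_sum_set[OF w(4), of "\<lambda>e. count_list (ends G e) x"]
      by (simp add: degree_in_def walk_edges_def)
    moreover have "count_list (walk_starts G W) x = 1"
      using w(3) that by (simp add: distinct_count_atmost_1 count_list_eq_length_filter distinct_length_filter)
    ultimately show ?thesis
      using walk_degree[OF w(1), of x] walk_verts_eq_starts[OF w(1)] by auto
  qed
  have conn: "connected_in G (walk_edges W) a b" 
    if a: "a \<in> set (walk_starts G W)" and b: "b \<in> set (walk_starts G W)" for a b
  proof -
    obtain A B where A: "W = A @ B" "walk G a B u"
      using walk_split[OF w(1), of a] a simple_cycle_verts(3)[OF assms] by auto
    obtain C D where C: "W = C @ D" "walk G u C b"
      using walk_split[OF w(1), of b] b simple_cycle_verts(3)[OF assms] by auto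
    have "walk G a (B @ C) b" using A C by (auto simp: walk_append)
    moreover have "walk_edges (B @ C) \<subseteq> walk_edges W"
      using A(1) C(1) by (metis Un_least sup_ge1 sup_ge2 walk_edges_simps(3))
    ultimately show ?thesis unfolding connected_in_def by blast
  qed
  show ?thesis unfolding circle_def simple_cycle_verts(1)[OF assms]
    using walk_in_edges[OF w(1)] walk_edges_length_2[OF w(1)] deg conn w(2)
    by (auto simp: walk_edges_def)
qed

lemma simple_cycle_around: "simple_cycle G u W \<Longrightarrow> around G (walk_edges W) u W"
  by (auto simp: simple_cycle_def around_def)

lemma prod_walk_sign:
  assumes "distinct (map fst W)"
  shows "(\<Prod>e\<in>walk_edges W. esign G e) = walk_sign G W"
  using prod.distinct_set_conv_list[OF assms, of "esign G"]
  by (simp add: walk_edges_def walk_sign_def case_prod_unfold comp_def)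

lemma simple_cycle_rotate:
  assumes "simple_cycle G u (A @ B)" "walk G u A x" "walk G x B u"
  shows "simple_cycle G x (B @ A)"
  using assms by (auto simp: simple_cycle_def walk_append)

lemma simple_cycle_rotate_to:
  assumes "simple_cycle G u W" "x \<in> set (walk_starts G W)"
  obtains W' where "simple_cycle G x W'" "walk_edges W' = walk_edges W"
    "walk_sign G W' = walk_sign G W"
proof -
  obtain A B where "W = A @ B" "walk G u A x" "walk G x B u"
    using walk_split[of G u W u x] assms simple_cycle_verts(3)[OF assms(1)]
    by (auto simp: simple_cycle_def)
  then show ?thesis
    using that[of "B @ A"] simple_cycle_rotate[of G u A B x] assms(1) by auto
qed

text \<open>For \<open>Q = []\<close> a loop becomes a cycle. The condition
  \<open>g \<notin> walk_edges Q\<close> prevents a path of length one from being retraced.\<close>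

lemma path_closing_edge:
  assumes "path_between G x Q v" "g \<in> edges G" "length (ends G g) = 2" "i < 2"
    "ends G g ! i = v" "ends G g ! (1 - i) = x" "g \<notin> walk_edges Q"
  shows "simple_cycle G x (Q @ [(g, i)])"
proof -
  have "walk G x Q v" "distinct (walk_verts G x Q)" using assms(1) by (auto simp: path_between_def)
  then show ?thesis using assms path_distinct_edges[of G x Q v]
    by (auto simp: simple_cycle_def walk_append walk_verts_eq_starts walk_edges_def)
qed

section \<open>The edge equations\<close>

text \<open>The linear form of \<open>e\<close> at the vector with coordinate \<open>a\<close> at
  \<open>None\<close> and coordinates \<open>x\<close> at the vertices
  (\<open>scalar_product_edge_vector\<close>). Keeping \<open>a\<close> separate lets inhomogeneous
  and homogeneous solutions share one calculus.\<close>

definition edge_eval ::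
    "('v, 'e, 'k::comm_ring_1) gsgraph \<Rightarrow> 'k \<Rightarrow> ('v \<Rightarrow> 'k) \<Rightarrow> 'e \<Rightarrow> 'k" where
  "edge_eval G a x e =
     gain G e * a + (\<Sum>i<length (ends G e). of_int (orient G e i) * x (ends G e ! i))"

text \<open>
  With \<open>a = 1\<close> this is the equation of the affine hyperplane of \<open>e\<close>, with \<open>a = 0\<close> its homogeneous part.
\<close>

definition solvable :: "('v, 'e, 'k::comm_ring_1) gsgraph \<Rightarrow> 'e set \<Rightarrow> bool" where
  "solvable G S \<longleftrightarrow> (\<exists>x. \<forall>e\<in>S. edge_eval G 1 x e = 0)"

lemma edge_eval_combine:
  "edge_eval G (a + c * b) (\<lambda>v. x v + c * y v) e = edge_eval G a x e + c * edge_eval G b y e"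
  by (simp add: edge_eval_def sum.distrib sum_distrib_left algebra_simps)

lemma walk_gain_simps [simp]:
  "walk_gain G [] = 0"
  "walk_gain G (s # W) =
     - gain G (fst s) * of_int (orient G (fst s) (snd s)) + of_int (esign G (fst s)) * walk_gain G W"
  by (simp_all add: walk_gain_def sum.lessThan_Suc_shift sum_distrib_left algebra_simps
      del: sum.lessThan_Suc)

lemma walk_gain_append [simp]:
  "walk_gain G (P @ Q) = walk_gain G P + of_int (walk_sign G P) * walk_gain G Q"
  by (induction P) (auto simp: algebra_simps)

locale gain_graph =
  fixes G :: "('v::finite, 'e, 'k::field) gsgraph"
  assumes wf: "gain_signed_graph G" and char: "(2::'k) \<noteq> 0"
begin

lemma
  assumes "e \<in> edges G"
  shows length_ends: "length (ends G e) \<le> 2"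
    and esign_cases: "esign G e = 1 \<or> esign G e = -1"
    and orient_cases: "i < length (ends G e) \<Longrightarrow> orient G e i = 1 \<or> orient G e i = -1"
    and orient_link: "length (ends G e) = 2 \<Longrightarrow> orient G e 0 * orient G e 1 = - esign G e"
  using assms wf unfolding gain_signed_graph_def by auto

lemma orient_nonzero: "e \<in> edges G \<Longrightarrow> i < length (ends G e) \<Longrightarrow> of_int (orient G e i) \<noteq> (0::'k)"
  using orient_cases[of e i] by auto

lemma edge_kinds:
  assumes "e \<in> edges G"
  obtains "loose_edge G e" "ends G e = []" | v where "half_edge G e" "ends G e = [v]"
  | v w where "ends G e = [v, w]"
proof -
  have "length (ends G e) = 0 \<or> length (ends G e) = 1 \<or> length (ends G e) = 2"
    using length_ends[OF assms] by linarith
  then show ?thesis using that assms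
    by (auto simp: length_Suc_conv numeral_2_eq_2 loose_edge_def half_edge_def)
qed

lemma edge_eval_half: "ends G e = [v] \<Longrightarrow> edge_eval G a x e = gain G e * a + of_int (orient G e 0) * x v"
  by (simp add: edge_eval_def)

text \<open>Multiplying by the sign of end \<open>i\<close> makes the coefficient there 1; the rule
  that the two orientation signs multiply to minus the edge sign then makes the other coefficient
  \<open>- esign G e\<close>. In this form an equation describes one step of a walk, loops
  included.\<close>

lemma edge_eval_step:
  assumes "e \<in> edges G" "length (ends G e) = 2" "i < 2"
  shows "of_int (orient G e i) * edge_eval G a x e =
    of_int (orient G e i) * gain G e * a + x (ends G e ! i) - of_int (esign G e) * x (ends G e ! (1 - i))"
proof -
  obtain v w where vw: "ends G e = [v, w]"
    using assms(2) by (auto simp: length_Suc_conv numeral_2_eq_2)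
  have o: "orient G e 0 = 1 \<or> orient G e 0 = -1" "orient G e (Suc 0) = 1 \<or> orient G e (Suc 0) = -1"
    "orient G e 0 * orient G e (Suc 0) = - esign G e"
    using orient_cases[OF assms(1), of 0] orient_cases[OF assms(1), of 1] orient_link[OF assms(1)]
      assms(2) by auto
  have es: "esign G e = - (orient G e 0 * orient G e (Suc 0))" using o(3) by simp
  have "i = 0 \<or> i = Suc 0" using assms(3) by auto
  then show ?thesis using o(1,2) by (elim disjE) (simp_all add: edge_eval_def vw es algebra_simps)
qed

lemma edge_eval_step_zero_iff:
  assumes "e \<in> edges G" "length (ends G e) = 2" "i < 2"
  shows "edge_eval G 0 x e = 0 \<longleftrightarrow> x (ends G e ! i) = of_int (esign G e) * x (ends G e ! (1 - i))"
  using edge_eval_step[OF assms, of 0 x] orient_cases[OF assms(1), of i] assms by auto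

section \<open>Gains of walks and circuits under a solution\<close>

lemma walk_sign_cases: "walk G u W v \<Longrightarrow> walk_sign G W = 1 \<or> walk_sign G W = -1"
proof (induction W arbitrary: u)
  case (Cons s W)
  then have "walk_sign G W = 1 \<or> walk_sign G W = -1" "fst s \<in> edges G" by (cases s; force)+
  then show ?case using esign_cases[of "fst s"] by auto
qed auto

lemma walk_gain_telescope:
  assumes "walk G u W v" "\<forall>e\<in>walk_edges W. edge_eval G 1 x e = 0"
  shows "walk_gain G W = x u - of_int (walk_sign G W) * x v"
  using assms
proof (induction W arbitrary: u)
  case (Cons s W)
  obtain e i where s: "s = (e, i)" by fastforce
  have w: "walk G (ends G e ! (1 - i)) W v" "e \<in> edges G" "length (ends G e) = 2" "i < 2"
    "ends G e ! i = u"
    using Cons.prems(1) s by auto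
  have e: "edge_eval G 1 x e = 0" using Cons.prems(2) s by auto
  have g: "walk_gain G W = x (ends G e ! (1 - i)) - of_int (walk_sign G W) * x v"
    using Cons.IH[OF w(1)] Cons.prems(2) s by auto
  have "of_int (orient G e i) * gain G e =
      of_int (esign G e) * x (ends G e ! (1 - i)) - x u"
    using edge_eval_step[OF w(2-4), of 1 x] e w(5) by (simp add: algebra_simps)
  then show ?case using s by (simp add: g algebra_simps)
qed auto

text \<open>Telescoping when the first equation may fail. No earlier sign multiplies its defect, so
  zero gain on a closed walk of sign 1 forces that defect to vanish.\<close>

lemma walk_gain_first_edge:
  assumes "walk G u ((p, i) # W) v" "\<forall>e\<in>walk_edges W. edge_eval G 1 x e = 0"
  shows "walk_gain G ((p, i) # W) =
    x u - of_int (walk_sign G ((p, i) # W)) * x v - of_int (orient G p i) * edge_eval G 1 x p"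
proof -
  have w: "walk G (ends G p ! (1 - i)) W v" "p \<in> edges G" "length (ends G p) = 2" "i < 2"
    "ends G p ! i = u" using assms(1) by auto
  show ?thesis
    using edge_eval_step[OF w(2-4), of 1 x] w(5)
    by (simp add: walk_gain_telescope[OF w(1) assms(2)] algebra_simps)
qed

text \<open>Orientation signs square to 1. The defect term is kept because \<open>h\<close> may be
  the one edge whose equation fails.\<close>

lemma half_gain:
  assumes "half_edge G h" "ends G h = [u]"
  shows "of_int (orient G h 0) * gain G h = of_int (orient G h 0) * edge_eval G 1 x h - x u"
proof -
  have "orient G h 0 = 1 \<or> orient G h 0 = -1"
    using orient_cases[of h 0] assms by (auto simp: half_edge_def)
  then show ?thesis by (auto simp: edge_eval_half[OF assms(2)])
qed

lemma handcuff_half_end: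
  assumes "handcuff G {h} u P v C" "half_edge G h"
  shows "ends G h = [u]"
proof -
  have "verts G {h} \<inter> set (walk_verts G u P) = {u}" using assms(1) by (simp add: handcuff_def)
  moreover obtain y where "ends G h = [y]"
    using assms(2) by (auto simp: half_edge_def length_Suc_conv)
  ultimately show ?thesis by (simp add: verts_def Int_insert_left split: if_splits)
qed

lemma handcuff_half_end2:
  assumes "handcuff G C u P v {h}" "half_edge G h"
  shows "ends G h = [v]"
proof -
  have "verts G {h} \<inter> set (walk_verts G u P) = {v}" using assms(1) by (simp add: handcuff_def)
  moreover obtain y where "ends G h = [y]"
    using assms(2) by (auto simp: half_edge_def length_Suc_conv)
  ultimately show ?thesis by (simp add: verts_def Int_insert_left split: if_splits)
qed

lemma around_sign: "around G C u W \<Longrightarrow> walk_sign G W = (\<Prod>e\<in>C. esign G e)"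
  using prod_walk_sign[of W G] by (auto simp: around_def)

lemma sign_square: "walk G u W v \<Longrightarrow> walk_sign G W * walk_sign G W = 1"
  using walk_sign_cases by fastforce

lemma circuit_gain_zero:
  assumes "circuit_gain G C g" "\<forall>e\<in>C. edge_eval G 1 x e = 0"
  shows "g = 0"
  using assms
proof (induction rule: circuit_gain.induct)
  case (loose e)
  then show ?case by (simp add: edge_eval_def loose_edge_def)
next
  case (positive_circle C u W)
  then show ?case using walk_gain_telescope[of u W u x] around_sign[OF positive_circle(2)]
    by (auto simp: around_def positive_circle_def)
next
  case (circle_circle C\<^sub>1 u P v C\<^sub>2 W\<^sub>1 W\<^sub>2)
  have W: "walk G u W\<^sub>1 u" "walk G u P v" "walk G v W\<^sub>2 v"
    using circle_circle by (auto simp: around_def handcuff_def path_between_def)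
  then have "walk G u (W\<^sub>1 @ P @ W\<^sub>2 @ rev_walk P) u" using walk_rev[OF W(2)] by (auto simp: walk_append)
  moreover have "walk_edges (W\<^sub>1 @ P @ W\<^sub>2 @ rev_walk P) = C\<^sub>1 \<union> walk_edges P \<union> C\<^sub>2"
    using circle_circle by (auto simp: around_def)
  ultimately have g: "walk_gain G (W\<^sub>1 @ P @ W\<^sub>2 @ rev_walk P) =
    x u - of_int (walk_sign G (W\<^sub>1 @ P @ W\<^sub>2 @ rev_walk P)) * x u"
    using walk_gain_telescope circle_circle.prems by metis
  \<comment> \<open>\<open>P\<close> is traversed twice, so its sign squares to 1, and the signs of
    the two negative circles cancel.\<close>
  have s: "walk_sign G (W\<^sub>1 @ P @ W\<^sub>2 @ rev_walk P) = 1"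
    using around_sign[OF circle_circle(4)] around_sign[OF circle_circle(5)] sign_square[OF W(2)]
      circle_circle(2,3) by (simp add: negative_circle_def algebra_simps)
  show ?case unfolding g s by simp
next
  case (half_circle h u P v C\<^sub>2 W\<^sub>2)
  have W: "walk G u P v" "walk G v W\<^sub>2 v"
    using half_circle by (auto simp: around_def handcuff_def path_between_def)
  then have "walk G u (P @ W\<^sub>2 @ rev_walk P) u" using walk_rev[OF W(1)] by (auto simp: walk_append)
  moreover have "walk_edges (P @ W\<^sub>2 @ rev_walk P) \<subseteq> {h} \<union> walk_edges P \<union> C\<^sub>2"
    using half_circle by (auto simp: around_def)
  ultimately have g: "walk_gain G (P @ W\<^sub>2 @ rev_walk P) =
    x u - of_int (walk_sign G (P @ W\<^sub>2 @ rev_walk P)) * x u"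
    using walk_gain_telescope half_circle.prems by (meson subsetD)
  \<comment> \<open>Only one negative circle is traversed, so the inner walk has gain
    \<open>2 * x u\<close>; the half edge at the two ends contributes \<open>- x u\<close> each
    time.\<close>
  have s: "walk_sign G (P @ W\<^sub>2 @ rev_walk P) = -1"
    using around_sign[OF half_circle(4)] sign_square[OF W(1)]
      half_circle(3) by (simp add: negative_circle_def algebra_simps)
  have h: "of_int (orient G h 0) * gain G h = - x u"
    using half_gain[OF half_circle(2) handcuff_half_end[OF half_circle(1,2)], of x]
      half_circle.prems by simp
  show ?case unfolding ultrawalk_gain_def g s using h by (simp add: algebra_simps)
next
  case (half_half h u P v h')
  have W: "walk G u P v"
    using half_half by (auto simp: handcuff_def path_between_def)
  have g: "walk_gain G P = x u - of_int (walk_sign G P) * x v"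
    using walk_gain_telescope[OF W] half_half.prems by auto
  have h: "of_int (orient G h 0) * gain G h = - x u"
    using half_gain[OF half_half(2) handcuff_half_end[OF half_half(1,2)], of x]
      half_half.prems by simp
  have h': "of_int (orient G h' 0) * gain G h' = - x v"
    using half_gain[OF half_half(3) handcuff_half_end2[OF half_half(1,3)], of x]
      half_half.prems by simp
  have "- gain G h' * of_int (walk_sign G P) * of_int (orient G h' 0) = of_int (walk_sign G P) * x v"
  proof -
    have "- gain G h' * of_int (walk_sign G P) * of_int (orient G h' 0) =
      - of_int (walk_sign G P) * (of_int (orient G h' 0) * gain G h')" by (simp add: algebra_simps)
    then show ?thesis unfolding h' by simp
  qed
  then show ?case unfolding ultrawalk_gain_def g using h by (simp add: algebra_simps)
qed

lemma solvable_hyperbalanced: "solvable G S \<Longrightarrow> hyperbalanced G S"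
  unfolding solvable_def hyperbalanced_def neutral_circuit_def
  using circuit_gain_zero by (meson subsetD)

end

section \<open>Minimal unsolvable edge sets\<close>

text \<open>The setting of a proof by contradiction: these assumptions are refuted in
  \<open>contradiction\<close>.\<close>

locale minimal_unsolvable = gain_graph G for G :: "('v::finite, 'e, 'k::field) gsgraph" +
  fixes S :: "'e set"
  assumes S_edges: "S \<subseteq> edges G" and hyp: "hyperbalanced G S"
    and unsolvable: "\<not> solvable G S" and minimal: "p \<in> S \<Longrightarrow> solvable G (S - {p})"
begin

lemma almost_solution:
  assumes "p \<in> S"
  obtains x where "\<forall>e\<in>S - {p}. edge_eval G 1 x e = 0" "edge_eval G 1 x p \<noteq> 0"
  using minimal[OF assms] unsolvable unfolding solvable_def by (metis Diff_iff singletonD)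

text \<open>Otherwise a multiple of \<open>y\<close>, with factor chosen to cancel the defect at
  \<open>p\<close>, would turn an almost-solution into a solution of all of
  \<open>S\<close>.\<close>

lemma dependent_edge:
  assumes "p \<in> S" "\<forall>e\<in>S - {p}. edge_eval G 0 y e = 0"
  shows "edge_eval G 0 y p = 0"
proof (rule ccontr)
  assume d: "edge_eval G 0 y p \<noteq> 0"
  obtain x where x: "\<forall>e\<in>S - {p}. edge_eval G 1 x e = 0"
    using almost_solution[OF assms(1)] by blast
  define c where "c = - edge_eval G 1 x p / edge_eval G 0 y p"
  have "edge_eval G 1 (\<lambda>v. x v + c * y v) e = 0" if "e \<in> S" for e
    using edge_eval_combine[of G 1 c 0 x y e] x assms(2) that d by (cases "e = p") (auto simp: c_def)
  then show False using unsolvable unfolding solvable_def by blast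
qed

lemma circuit_gain_in_S: "sign_circuit G C \<Longrightarrow> C \<subseteq> S \<Longrightarrow> circuit_gain G C g \<Longrightarrow> g = 0"
  using hyp unfolding hyperbalanced_def neutral_circuit_def by blast

lemma no_loose: 
  assumes "p \<in> S" 
  shows "\<not> loose_edge G p"
proof
  assume l: "loose_edge G p"
  then have "gain G p = 0"
    using circuit_gain_in_S[of "{p}"] circuit_gain.loose[OF l] assms by (auto simp: sign_circuit_def)
  moreover obtain x where "edge_eval G 1 x p \<noteq> 0" using almost_solution[OF assms] by blast
  ultimately show False using l by (simp add: edge_eval_def loose_edge_def)
qed

lemma cycle_negative:
  assumes "simple_cycle G u W" "walk_edges W \<subseteq> S"
  shows "walk_sign G W = -1"
proof (rule ccontr)
  assume "walk_sign G W \<noteq> -1"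
  moreover have w: "walk G u W u" "W \<noteq> []" "distinct (map fst W)"
    using assms by (auto simp: simple_cycle_def)
  ultimately have s: "walk_sign G W = 1" using walk_sign_cases by blast
  have pc: "positive_circle G (walk_edges W)"
    using simple_cycle_circle[OF assms(1)] prod_walk_sign[OF w(3), of G] s
    by (simp add: positive_circle_def)
  then have g: "walk_gain G W = 0"
    using circuit_gain_in_S[OF _ assms(2)] circuit_gain.positive_circle[OF pc simple_cycle_around[OF assms(1)]]
    by (auto simp: sign_circuit_def)
  obtain p i W' where W: "W = (p, i) # W'" using w(2) by (metis list.exhaust surj_pair)
  have p: "p \<in> S" "walk_edges W' \<subseteq> S - {p}" using W assms(2) w(3) by (auto simp: walk_edges_def)
  then obtain x where x: "\<forall>e\<in>S - {p}. edge_eval G 1 x e = 0" "edge_eval G 1 x p \<noteq> 0"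
    using almost_solution by blast
  have "\<forall>e\<in>walk_edges W'. edge_eval G 1 x e = 0" using x(1) p(2) by blast
  from walk_gain_first_edge[OF w(1)[unfolded W] this]
  have "of_int (orient G p i) * edge_eval G 1 x p = 0"
    unfolding g[unfolded W] s[unfolded W] by simp
  moreover have "of_int (orient G p i) \<noteq> (0::'k)"
    using orient_nonzero[of p i] w(1) W by auto
  ultimately show False using x(2) by simp
qed

lemma cycle_negative_circle:
  assumes "simple_cycle G u W" "walk_edges W \<subseteq> S"
  shows "negative_circle G (walk_edges W)"
  using simple_cycle_circle[OF assms(1)] prod_walk_sign[of W G] cycle_negative[OF assms] assms(1)
  by (simp add: negative_circle_def simple_cycle_def)

section \<open>Excluding the three kinds of handcuff\<close>

text \<open>The failing edge is the first one of the first circle: the circuit walk passes it once,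
  whereas it passes the edges of \<open>P\<close> twice.\<close>

lemma no_handcuff_circles:
  assumes W1: "simple_cycle G u W\<^sub>1" "walk_edges W\<^sub>1 \<subseteq> S"
    and W2: "simple_cycle G v W\<^sub>2" and P: "path_between G u P v"
    and sub: "walk_edges P \<union> walk_edges W\<^sub>2 \<subseteq> S - walk_edges W\<^sub>1"
    and v: "verts G (walk_edges W\<^sub>1) \<inter> set (walk_verts G u P) = {u}"
      "verts G (walk_edges W\<^sub>2) \<inter> set (walk_verts G u P) = {v}"
      "verts G (walk_edges W\<^sub>1) \<inter> verts G (walk_edges W\<^sub>2) = (if P = [] then {u} else {})"
  shows False
proof -
  have w: "walk G u W\<^sub>1 u" "W\<^sub>1 \<noteq> []" "distinct (map fst W\<^sub>1)" "walk G u P v" "walk G v W\<^sub>2 v"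
    using W1 W2 P by (auto simp: simple_cycle_def path_between_def)
  have nc: "negative_circle G (walk_edges W\<^sub>1)" "negative_circle G (walk_edges W\<^sub>2)"
    using cycle_negative_circle W1 W2 sub by blast+
  obtain p i W' where W: "W\<^sub>1 = (p, i) # W'" using w(2) by (metis list.exhaust surj_pair)
  have "walk_edges W\<^sub>1 \<noteq> walk_edges W\<^sub>2" using sub W by auto
  then have h: "handcuff G (walk_edges W\<^sub>1) u P v (walk_edges W\<^sub>2)"
    using nc v P by (simp add: handcuff_def negative_figure_def)
  have "walk_gain G (W\<^sub>1 @ P @ W\<^sub>2 @ rev_walk P) = 0"
  proof (rule circuit_gain_in_S)
    show "circuit_gain G (walk_edges W\<^sub>1 \<union> walk_edges P \<union> walk_edges W\<^sub>2)
      (walk_gain G (W\<^sub>1 @ P @ W\<^sub>2 @ rev_walk P))"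
      by (rule circuit_gain.circle_circle[OF h nc simple_cycle_around[OF W1(1)] simple_cycle_around[OF W2]])
    show "sign_circuit G (walk_edges W\<^sub>1 \<union> walk_edges P \<union> walk_edges W\<^sub>2)"
      using h unfolding sign_circuit_def by blast
  qed (use sub W1 in auto)
  then have g: "walk_gain G ((p, i) # W' @ P @ W\<^sub>2 @ rev_walk P) = 0"
    by (simp only: W append_Cons)
  have p: "p \<in> S" "walk_edges (W' @ P @ W\<^sub>2 @ rev_walk P) \<subseteq> S - {p}"
    using W W1(2) w(3) sub by (auto simp: walk_edges_def rev_walk_def)
  then obtain x where x: "\<forall>e\<in>S - {p}. edge_eval G 1 x e = 0" "edge_eval G 1 x p \<noteq> 0"
    using almost_solution by blast
  have "walk G u (W\<^sub>1 @ P @ W\<^sub>2 @ rev_walk P) u"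
    using w walk_rev[OF w(4)] by (auto simp: walk_append)
  then have ww: "walk G u ((p, i) # W' @ P @ W\<^sub>2 @ rev_walk P) u" by (simp add: W)
  have w2: "walk_sign G W\<^sub>2 = -1" using cycle_negative[OF W2] sub by blast
  have "walk_sign G (W\<^sub>1 @ P @ W\<^sub>2 @ rev_walk P) = 1"
    using cycle_negative[OF W1] w2 sign_square[OF w(4)] by (simp add: mult.left_commute)
  then have s: "walk_sign G ((p, i) # W' @ P @ W\<^sub>2 @ rev_walk P) = 1" by (simp add: W)
  have "\<forall>e\<in>walk_edges (W' @ P @ W\<^sub>2 @ rev_walk P). edge_eval G 1 x e = 0" using x(1) p(2) by blast
  from walk_gain_first_edge[OF ww this] have "of_int (orient G p i) * edge_eval G 1 x p = 0"
    unfolding g s by simp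
  moreover have "of_int (orient G p i) \<noteq> (0::'k)"
    using orient_nonzero[of p i] w(1) W by auto
  ultimately show False using x(2) by simp
qed

text \<open>The half edge opens and closes the ultrawalk, and the part in between has sign -1, so
  its two contributions add up. Neutrality gives that twice the defect is zero, and the
  characteristic allows division by 2.\<close>

lemma no_handcuff_half_circle:
  assumes h: "half_edge G h" "ends G h = [u]" "h \<in> S"
    and W2: "simple_cycle G v W\<^sub>2" and P: "path_between G u P v"
    and sub: "walk_edges P \<union> walk_edges W\<^sub>2 \<subseteq> S"
    and v: "verts G (walk_edges W\<^sub>2) \<inter> set (walk_verts G u P) = {v}"
      "{u} \<inter> verts G (walk_edges W\<^sub>2) = (if P = [] then {u} else {})"
  shows False
proof -
  have w: "walk G u P v" "walk G v W\<^sub>2 v"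
    using W2 P by (auto simp: simple_cycle_def path_between_def)
  have ww: "walk G u (P @ W\<^sub>2 @ rev_walk P) u"
    using w walk_rev[OF w(1)] by (auto simp: walk_append)
  have notin: "h \<notin> walk_edges (P @ W\<^sub>2 @ rev_walk P)"
    using walk_edges_length_2[OF ww, of h] h(2) by auto
  have nc: "negative_circle G (walk_edges W\<^sub>2)" using cycle_negative_circle W2 sub by blast
  have "{h} \<noteq> walk_edges W\<^sub>2" using notin by auto
  then have hc: "handcuff G {h} u P v (walk_edges W\<^sub>2)"
    using nc v P h walk_verts_nonempty[of u G P]
    by (auto simp: handcuff_def negative_figure_def verts_def)
  have g: "ultrawalk_gain G (Some h) (P @ W\<^sub>2 @ rev_walk P) (Some h) = 0"
  proof (rule circuit_gain_in_S)
    show "circuit_gain G ({h} \<union> walk_edges P \<union> walk_edges W\<^sub>2)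
      (ultrawalk_gain G (Some h) (P @ W\<^sub>2 @ rev_walk P) (Some h))"
      by (rule circuit_gain.half_circle[OF hc h(1) nc simple_cycle_around[OF W2]])
    show "sign_circuit G ({h} \<union> walk_edges P \<union> walk_edges W\<^sub>2)"
      using hc unfolding sign_circuit_def by blast
  qed (use sub h in auto)
  obtain x where x: "\<forall>e\<in>S - {h}. edge_eval G 1 x e = 0" "edge_eval G 1 x h \<noteq> 0"
    using almost_solution[OF h(3)] by blast
  have s: "walk_sign G (P @ W\<^sub>2 @ rev_walk P) = -1"
    using cycle_negative[OF W2] sub sign_square[OF w(1)] by (auto simp: algebra_simps)
  have "walk_edges (P @ W\<^sub>2 @ rev_walk P) \<subseteq> S - {h}" using notin sub by auto
  then have "\<forall>e\<in>walk_edges (P @ W\<^sub>2 @ rev_walk P). edge_eval G 1 x e = 0" using x(1) by blast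
  from walk_gain_telescope[OF ww this] have wg: "walk_gain G (P @ W\<^sub>2 @ rev_walk P) = x u + x u"
    unfolding s by simp
  have hg: "of_int (orient G h 0) * gain G h = of_int (orient G h 0) * edge_eval G 1 x h - x u"
    by (rule half_gain[OF h(1,2)])
  have "2 * (of_int (orient G h 0) * gain G h) + 2 * x u = 0"
    using g unfolding ultrawalk_gain_def wg s by (simp add: algebra_simps)
  then have "2 * (of_int (orient G h 0) * edge_eval G 1 x h) = 0"
    unfolding hg by (simp add: algebra_simps)
  moreover have "of_int (orient G h 0) \<noteq> (0::'k)"
    using orient_nonzero[of h 0] h S_edges by auto
  ultimately show False using x(2) char by simp
qed

text \<open>Each figure has a single vertex, so any path from \<open>u\<close> to \<open>v\<close>
  meets the figures only at its ends. The defect of \<open>h\<close> enters the gain once, with a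
  sign.\<close>

lemma no_handcuff_halves:
  assumes h: "half_edge G h" "ends G h = [u]" "h \<in> S"
    and h': "half_edge G h'" "ends G h' = [v]" "h' \<in> S"
    and ne: "h \<noteq> h'" and P: "path_between G u P v" and sub: "walk_edges P \<subseteq> S"
  shows False
proof -
  have w: "walk G u P v" "distinct (walk_verts G u P)" using P by (auto simp: path_between_def)
  have notin: "h \<notin> walk_edges P" "h' \<notin> walk_edges P"
    using walk_edges_length_2[OF w(1)] h(2) h'(2) by fastforce+
  \<comment> \<open>A path has distinct vertices, so equal ends mean length zero; this matches the
    case distinction in \<open>handcuff\<close>.\<close>
  have "P = [] \<longleftrightarrow> u = v"
    using w by (cases P) (auto dest: walk_end_in_verts)
  then have hc: "handcuff G {h} u P v {h'}"
    using P h h' ne walk_verts_nonempty[of u G P] walk_end_in_verts[OF w(1)]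
    by (auto simp: handcuff_def negative_figure_def verts_def)
  have g: "ultrawalk_gain G (Some h) P (Some h') = 0"
  proof (rule circuit_gain_in_S)
    show "circuit_gain G ({h} \<union> walk_edges P \<union> {h'}) (ultrawalk_gain G (Some h) P (Some h'))"
      by (rule circuit_gain.half_half[OF hc h(1) h'(1)])
    show "sign_circuit G ({h} \<union> walk_edges P \<union> {h'})"
      using hc unfolding sign_circuit_def by blast
  qed (use sub h h' in auto)
  obtain x where x: "\<forall>e\<in>S - {h}. edge_eval G 1 x e = 0" "edge_eval G 1 x h \<noteq> 0"
    using almost_solution[OF h(3)] by blast
  have wg: "walk_gain G P = x u - of_int (walk_sign G P) * x v"
    by (rule walk_gain_telescope[OF w(1)]) (use x(1) sub notin in auto)
  have hg: "of_int (orient G h 0) * gain G h = of_int (orient G h 0) * edge_eval G 1 x h - x u"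
    by (rule half_gain[OF h(1,2)])
  have "of_int (orient G h' 0) * gain G h' = - x v"
    using half_gain[OF h'(1,2), of x] x(1) h'(3) ne by auto
  then have hg': "- gain G h' * of_int (walk_sign G P) * of_int (orient G h' 0) =
      of_int (walk_sign G P) * x v"
    by (metis (no_types, opaque_lifting) mult.assoc mult.commute mult_minus_left mult_minus_right minus_minus)
  have "of_int (orient G h 0) * edge_eval G 1 x h = 0"
    using g unfolding ultrawalk_gain_def wg option.case hg hg' by simp
  moreover have "of_int (orient G h 0) \<noteq> (0::'k)"
    using orient_nonzero[of h 0] h S_edges by auto
  ultimately show False using x(2) by simp
qed

text \<open>Otherwise the indicator function of \<open>v\<close> would satisfy all homogeneous
  equations off \<open>p\<close>, hence also that of \<open>p\<close>. This is impossible for a half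
  edge or a link at \<open>v\<close>; a loop in \<open>S\<close> is negative by
  \<open>cycle_negative\<close>, and its equation would give 2 = 0.\<close>

lemma other_edge_at:
  assumes "p \<in> S" "v \<in> set (ends G p)"
  shows "\<exists>g\<in>S - {p}. v \<in> set (ends G g)"
proof (rule ccontr)
  assume "\<not> ?thesis"
  then have 0: "\<forall>e\<in>S - {p}. v \<notin> set (ends G e)" by blast
  define y :: "'v \<Rightarrow> 'k" where "y = (\<lambda>w. if w = v then 1 else 0)"
  have "\<forall>e\<in>S - {p}. edge_eval G 0 y e = 0"
    using 0 nth_mem by (fastforce simp: edge_eval_def y_def intro!: sum.neutral)
  then have z: "edge_eval G 0 y p = 0" using dependent_edge assms(1) by blast
  have pe: "p \<in> edges G" using assms(1) S_edges by blast
  show False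
  proof (rule edge_kinds[OF pe])
    assume "ends G p = []"
    then show False using assms(2) by simp
  next
    fix w assume "half_edge G p" "ends G p = [w]"
    then show False using z assms(2) orient_cases[OF pe, of 0] by (auto simp: edge_eval_half y_def)
  next
    fix a b assume ab: "ends G p = [a, b]"
    have eq: "y a = of_int (esign G p) * y b"
      using edge_eval_step_zero_iff[OF pe, of 0 y] z ab by simp
    have "a = v \<and> b = v"
      using eq esign_cases[OF pe] assms(2) ab by (auto simp: y_def split: if_splits)
    then have ab: "ends G p = [v, v]" using ab by simp
    have cyc: "simple_cycle G v [(p, 0)]" using ab pe by (simp add: simple_cycle_def)
    have "esign G p = -1" using cycle_negative[OF cyc] assms(1) by simp
    then have "2 * y v = 0" using eq \<open>a = v \<and> b = v\<close> by simp
    then show False using char by (simp add: y_def)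
  qed
qed

end

section \<open>Longest paths and signs along paths\<close>

lemma path_length_bound:
  fixes G :: "('v::finite, 'e, 'k) gsgraph"
  assumes "path_between G u P v"
  shows "length P < CARD('v)"
proof -
  have "length (walk_verts G u P) \<le> CARD('v)"
    using assms distinct_card[of "walk_verts G u P"] card_mono[of UNIV "set (walk_verts G u P)"]
    by (auto simp: path_between_def)
  then show ?thesis by (simp add: walk_verts_def)
qed

context gain_graph
begin

text \<open>
  The path is chosen of maximal length, so the edge \<open>g\<close> at its last vertex cannot prolong it.
\<close>

lemma longest_path_edge:
  assumes T: "T \<subseteq> edges G"
    and other: "\<And>p v. p \<in> T \<Longrightarrow> v \<in> set (ends G p) \<Longrightarrow> v \<notin> X \<Longrightarrow> \<exists>g\<in>T - {p}. v \<in> set (ends G g)"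
    and start: "g\<^sub>0 \<in> T - N" "w\<^sub>0 \<in> X" "w\<^sub>0 \<in> set (ends G g\<^sub>0)"
    and N: "\<And>e. e \<in> N \<Longrightarrow> set (ends G e) \<subseteq> X"
  shows "\<exists>w P v g. w \<in> X \<and> path_between G w P v \<and> walk_edges P \<subseteq> T - N \<and>
    set (walk_verts G w P) \<inter> X = {w} \<and> g \<in> T - N \<and> g \<notin> walk_edges P \<and> v \<in> set (ends G g) \<and>
    set (ends G g) \<subseteq> X \<union> set (walk_verts G w P)"
proof -
  define Q where "Q = (\<lambda>(w, P, v, g). w \<in> X \<and> path_between G w P v \<and> walk_edges P \<subseteq> T - N \<and>
    set (walk_verts G w P) \<inter> X = {w} \<and> g \<in> T - N \<and> g \<notin> walk_edges P \<and> v \<in> set (ends G g))"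
  have Q0: "Q (w\<^sub>0, [], w\<^sub>0, g\<^sub>0)" using start by (auto simp: Q_def path_between_def)
  have bound: "\<forall>y. Q y \<longrightarrow> length (fst (snd y)) < CARD('v)"
    using path_length_bound unfolding Q_def by fastforce
  obtain y where y: "Q y" and max: "\<forall>z. Q z \<longrightarrow> length (fst (snd z)) \<le> length (fst (snd y))"
    using ex_has_greatest_nat[OF Q0 bound] by blast
  obtain w P v g where yw: "y = (w, P, v, g)" by (cases y)
  have q: "w \<in> X" "path_between G w P v" "walk_edges P \<subseteq> T - N"
    "set (walk_verts G w P) \<inter> X = {w}" "g \<in> T - N" "g \<notin> walk_edges P" "v \<in> set (ends G g)"
    using y yw by (auto simp: Q_def)
  have W: "walk G w P v" "distinct (walk_verts G w P)" using q(2) by (auto simp: path_between_def)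
  have vP: "v \<in> set (walk_verts G w P)" using walk_end_in_verts[OF W(1)] .
  have "x \<in> X \<union> set (walk_verts G w P)" if x: "x \<in> set (ends G g)" for x
  proof (rule ccontr)
    assume nx: "x \<notin> X \<union> set (walk_verts G w P)"
    have gT: "g \<in> T" "g \<in> edges G" using q(5) T by auto
    have "x \<noteq> v" using nx vP by auto
    have len: "length (ends G g) = 2"
      using edge_kinds[OF gT(2)] x q(7) \<open>x \<noteq> v\<close> by (metis empty_iff empty_set length_Cons list.size(3) numeral_2_eq_2 set_ConsD)
    obtain i where i: "i < 2" "ends G g ! i = v" using q(7) len by (metis in_set_conv_nth)
    have xi: "ends G g ! (1 - i) = x"
      using set_two_indexed[OF len i(1)] x i(2) \<open>x \<noteq> v\<close> by auto
    let ?P = "P @ [(g, i)]"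
    have walk': "walk G w ?P x" using W(1) i xi len gT by (auto simp: walk_append)
    have verts': "walk_verts G w ?P = walk_verts G w P @ [x]"
      using walk_verts_append[OF W(1), of "[(g, i)]"] walk_verts_eq_starts[OF W(1)] xi by simp
    have path': "path_between G w ?P x" using walk' verts' W(2) nx by (simp add: path_between_def)
    \<comment> \<open>Edges of \<open>N\<close> have their ends in \<open>X\<close>, and edges of
      the path have theirs on the path. As \<open>x\<close> avoids both, another edge at
      \<open>x\<close> is new, and the prolonged path again satisfies \<open>Q\<close>, against
      maximality.\<close>
    obtain g' where g': "g' \<in> T - {g}" "x \<in> set (ends G g')"
      using other[OF gT(1) x] nx by blast
    have "g' \<notin> N" using N g'(2) nx by blast
    moreover have "g' \<notin> walk_edges P"
      using walk_ends_in_verts[OF W(1), of g'] g'(2) nx by blast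
    ultimately have "Q (w, ?P, x, g')"
      using path' q g' verts' nx by (auto simp: Q_def)
    then have "length ?P \<le> length P" using max yw by fastforce
    then show False by simp
  qed
  then show ?thesis using q by blast
qed

end

text \<open>The value 1 is propagated from \<open>u\<close> by the edge signs; distinct vertices
  make this consistent. Vanishing off the path makes the equations of edges that avoid the path hold
  too.\<close>

lemma path_signs:
  fixes G :: "('v, 'e, 'k::comm_ring_1) gsgraph"
  assumes "path_between G u Q v"
    "\<And>e. e \<in> walk_edges Q \<Longrightarrow> esign G e = 1 \<or> esign G e = -1"
  shows "\<exists>y :: 'v \<Rightarrow> 'k. y u = 1 \<and> y v = of_int (walk_sign G Q) \<and>
    (\<forall>x. x \<notin> set (walk_verts G u Q) \<longrightarrow> y x = 0) \<and>
    (\<forall>(e, i)\<in>set Q. y (ends G e ! i) = of_int (esign G e) * y (ends G e ! (1 - i)))"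
  using assms
proof (induction Q arbitrary: u)
  case Nil
  then show ?case
    by (intro exI[of _ "\<lambda>x. if x = u then 1 else 0"]) (auto simp: path_between_def)
next
  case (Cons s Q)
  obtain e i where s: "s = (e, i)" by fastforce
  let ?w = "ends G e ! (1 - i)"
  have Q: "path_between G ?w Q v" "u \<notin> set (walk_verts G ?w Q)" "ends G e ! i = u"
    using Cons.prems s by (auto simp: path_between_def)
  obtain y :: "'v \<Rightarrow> 'k" where y: "y ?w = 1" "y v = of_int (walk_sign G Q)"
    "\<And>x. x \<notin> set (walk_verts G ?w Q) \<Longrightarrow> y x = 0"
    "\<And>f j. (f, j) \<in> set Q \<Longrightarrow> y (ends G f ! j) = of_int (esign G f) * y (ends G f ! (1 - j))"
    using Cons.IH[OF Q(1)] Cons.prems(2) by fastforce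
  have W: "walk G ?w Q v" using Q(1) by (simp add: path_between_def)
  have e: "esign G e = 1 \<or> esign G e = -1" using Cons.prems(2)[of e] s by simp
  \<comment> \<open>The old function is rescaled by the sign of \<open>e\<close>, so that the new
    start gets the value 1.\<close>
  define z where "z = (\<lambda>x. if x = u then 1 else of_int (esign G e) * y x)"
  have zw: "z ?w = of_int (esign G e)" using Q(2) y(1) walk_verts_nonempty[of ?w G Q]
    by (auto simp: z_def)
  have zv: "z v = of_int (walk_sign G (s # Q))" using Q(2) y(2) walk_end_in_verts[OF W]
    by (auto simp: z_def s)
  have zz: "z (ends G f ! j) = of_int (esign G f) * z (ends G f ! (1 - j))" if "(f, j) \<in> set Q" for f j
  proof -
    have f: "f \<in> walk_edges Q" using that by (force simp: walk_edges_def)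
    have "j < 2" "length (ends G f) = 2"
      using walk_index_less[OF W that] walk_edges_length_2[OF W f] by auto
    then have "{ends G f ! j, ends G f ! (1 - j)} \<subseteq> set (walk_verts G ?w Q)"
      using walk_ends_in_verts[OF W f] set_two_indexed[of "ends G f" j] by simp
    then have "ends G f ! j \<noteq> u" "ends G f ! (1 - j) \<noteq> u" using Q(2) by auto
    then show ?thesis using y(4)[OF that] by (simp add: z_def)
  qed
  have z0: "z x = 0" if "x \<notin> set (walk_verts G u (s # Q))" for x
    using that y(3) s by (auto simp: z_def)
  have "z (ends G e ! i) = of_int (esign G e) * z ?w"
    using zw Q(3) e by (auto simp: z_def)
  moreover have "z u = 1" by (simp add: z_def)
  ultimately show ?case using zv zz z0 s by (intro exI[of _ z]) auto
qed

section \<open>Closing up paths to forbidden circuits\<close>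

context minimal_unsolvable
begin

lemma S_nonempty: "S \<noteq> {}"
  using unsolvable by (auto simp: solvable_def)

text \<open>
  An isolated negative cycle would be independent of the other edges: the walk signs along it, extended
  by zero, satisfy all homogeneous equations of \<open>S\<close> except that of the first edge.
\<close>

lemma edge_leaving_cycle:
  assumes "simple_cycle G u W" "walk_edges W \<subseteq> S"
  shows "\<exists>g\<in>S - walk_edges W. set (ends G g) \<inter> set (walk_starts G W) \<noteq> {}"
proof (rule ccontr)
  assume "\<not> ?thesis"
  then have away: "set (ends G g) \<inter> set (walk_starts G W) = {}" if "g \<in> S - walk_edges W" for g
    using that by blast
  have w: "walk G u W u" "W \<noteq> []" "distinct (walk_starts G W)" "distinct (map fst W)"
    using assms by (auto simp: simple_cycle_def)
  obtain p i Q where W: "W = (p, i) # Q" using w(2) by (metis list.exhaust surj_pair)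
  let ?v = "ends G p ! (1 - i)"
  have p: "p \<in> edges G" "length (ends G p) = 2" "i < 2" "ends G p ! i = u" "walk G ?v Q u"
    using w(1) W by auto
  have path: "path_between G ?v Q u"
    using p(4,5) w(3) W by (auto simp: path_between_def walk_verts_eq_starts)
  have vQ: "set (walk_verts G ?v Q) = set (walk_starts G W)"
    using walk_verts_eq_starts[OF p(5)] W p(4) by auto
  have "esign G e = 1 \<or> esign G e = -1" if "e \<in> walk_edges Q" for e
    using esign_cases walk_in_edges[OF p(5)] that by blast
  from path_signs[OF path this] obtain y :: "'v \<Rightarrow> 'k" where y: "y ?v = 1" "y u = of_int (walk_sign G Q)"
    "\<And>x. x \<notin> set (walk_verts G ?v Q) \<Longrightarrow> y x = 0"
    "\<And>e i. (e, i) \<in> set Q \<Longrightarrow> y (ends G e ! i) = of_int (esign G e) * y (ends G e ! (1 - i))"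
    by fastforce
  have "edge_eval G 0 y e = 0" if e: "e \<in> S - {p}" for e
  proof (cases "e \<in> walk_edges W")
    case True
    then obtain j where j: "(e, j) \<in> set Q" using e W by (auto simp: walk_edges_def)
    then show ?thesis
      using edge_eval_step_zero_iff[of e j y] y(4)[OF j] walk_index_less[OF p(5) j]
        walk_edges_length_2[OF p(5), of e] e S_edges
      by (force simp: walk_edges_def)
  next
    case False
    then have "set (ends G e) \<inter> set (walk_verts G ?v Q) = {}" using away[of e] e vQ by auto
    then have "y (ends G e ! k) = 0" if "k < length (ends G e)" for k
      using y(3) nth_mem[OF that] by blast
    then show ?thesis by (auto simp: edge_eval_def)
  qed
  \<comment> \<open>Dependence of \<open>p\<close> closes the cycle consistently: its sign would be
    the square of that of \<open>p\<close>, thus 1, whereas it is -1. The two differ in the field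
    because 2 is nonzero.\<close>
  then have "edge_eval G 0 y p = 0" using dependent_edge[of p y] assms(2) W by simp
  then have eq: "of_int (walk_sign G Q) = (of_int (esign G p) :: 'k)"
    using edge_eval_step_zero_iff[OF p(1-3), of y] y(1,2) p(4) by simp
  have "esign G p * walk_sign G Q = -1" using cycle_negative[OF assms] W by simp
  then have "of_int (esign G p * walk_sign G Q) = (-1 :: 'k)" by simp
  then have "of_int (esign G p) * of_int (esign G p) = (-1 :: 'k)" using eq by simp
  then have "(1::'k) = -1" using esign_cases[OF p(1)] by auto
  then show False using char by (metis add.right_inverse one_add_one)
qed

text \<open>The edge \<open>g\<close> at the last vertex runs back to a vertex \<open>x\<close> of
  the path. This cuts the path into a tail \<open>A\<close>, later the connecting path of a
  handcuff, and a part \<open>B\<close> that \<open>g\<close> completes to a cycle;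
  \<open>B = []\<close> if \<open>g\<close> is a loop.\<close>

lemma finish_path:
  assumes P: "path_between G w P v" and g: "g \<in> S" "g \<notin> walk_edges P" "length (ends G g) = 2"
    "v \<in> set (ends G g)" "set (ends G g) \<subseteq> set (walk_verts G w P)"
  obtains A B x i where "P = A @ B" "path_between G w A x" "path_between G x B v"
    "simple_cycle G x (B @ [(g, i)])" "set (walk_starts G (B @ [(g, i)])) = set (walk_verts G x B)"
    "set (walk_verts G w A) \<inter> set (walk_verts G x B) = {x}"
proof -
  have W: "walk G w P v" "distinct (walk_verts G w P)" using P by (auto simp: path_between_def)
  obtain i where i: "i < 2" "ends G g ! i = v" using g(3,4) by (metis in_set_conv_nth)
  let ?x = "ends G g ! (1 - i)"
  have "?x \<in> set (walk_verts G w P)" using set_two_indexed[OF g(3) i(1)] g(5) by simp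
  from walk_split[OF W(1) this] obtain A B where AB: "P = A @ B" "walk G w A ?x" "walk G ?x B v"
    by blast
  have vv: "walk_verts G w P = walk_starts G A @ walk_verts G ?x B"
    using walk_verts_append[OF AB(2)] AB(1) by simp
  have vA: "walk_verts G w A = walk_starts G A @ [?x]" using walk_verts_eq_starts[OF AB(2)] .
  have paths: "path_between G w A ?x" "path_between G ?x B v"
    using AB W(2) vv vA walk_verts_nonempty[of ?x G B] by (auto simp: path_between_def)
  have cyc: "simple_cycle G ?x (B @ [(g, i)])"
    by (rule path_closing_edge[OF paths(2)]) (use g i S_edges AB(1) in auto)
  show ?thesis
  proof (rule that[OF AB(1) paths cyc])
    show "set (walk_starts G (B @ [(g, i)])) = set (walk_verts G ?x B)"
      using walk_verts_eq_starts[OF AB(3)] i(2) by simp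
    show "set (walk_verts G w A) \<inter> set (walk_verts G ?x B) = {?x}"
      using W(2) vv vA walk_verts_nonempty[of ?x G B] by auto
  qed
qed

text \<open>A longest path is taken with \<open>X\<close> a single vertex and \<open>N\<close>
  empty, so the final edge can only return to the path itself.\<close>

lemma cycle_exists:
  assumes "\<And>e. e \<in> S \<Longrightarrow> \<not> half_edge G e"
  obtains u W where "simple_cycle G u W" "walk_edges W \<subseteq> S"
proof -
  have len: "length (ends G e) = 2" if "e \<in> S" for e
    using edge_kinds[of e] that assms[of e] no_loose[of e] S_edges
    by (metis One_nat_def Suc_1 length_Cons list.size(3) subsetD)
  obtain p where p: "p \<in> S" using S_nonempty by blast
  then have "ends G p ! 0 \<in> set (ends G p)" using len[of p] by simp
  from longest_path_edge[OF S_edges _ _ _ this, of "{ends G p ! 0}" "{}"] p other_edge_at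
  obtain P v g where g: "path_between G (ends G p ! 0) P v" "walk_edges P \<subseteq> S" "g \<in> S"
    "g \<notin> walk_edges P" "v \<in> set (ends G g)"
    "set (ends G g) \<subseteq> {ends G p ! 0} \<union> set (walk_verts G (ends G p ! 0) P)"
    by (auto; metis)
  have "set (ends G g) \<subseteq> set (walk_verts G (ends G p ! 0) P)"
    using g(6) walk_verts_nonempty[of "ends G p ! 0" G P] by auto
  from finish_path[OF g(1,3,4) len[OF g(3)] g(5) this] obtain A B x i
    where "P = A @ B" "simple_cycle G x (B @ [(g, i)])" by metis
  then show ?thesis using that[of x "B @ [(g, i)]"] g by auto
qed

text \<open>The figure \<open>{h}\<close> has only the vertex \<open>u\<close>, from which the path
  starts, so a return to the figure is a return to the path. No theta graph arises: the last edge is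
  a second half edge or closes a circle, and \<open>h\<close> completes a handcuff.\<close>

lemma no_half_edge:
  assumes "h \<in> S" "half_edge G h"
  shows False
proof -
  obtain u where u: "ends G h = [u]" using assms(2) by (auto simp: half_edge_def length_Suc_conv)
  obtain g\<^sub>0 where g\<^sub>0: "g\<^sub>0 \<in> S - {h}" "u \<in> set (ends G g\<^sub>0)"
    using other_edge_at[OF assms(1), of u] u by auto
  from longest_path_edge[OF S_edges _ g\<^sub>0(1) _ g\<^sub>0(2), of "{u}"] u other_edge_at
  obtain P v g where g: "path_between G u P v" "walk_edges P \<subseteq> S - {h}" "g \<in> S - {h}"
    "g \<notin> walk_edges P" "v \<in> set (ends G g)" "set (ends G g) \<subseteq> {u} \<union> set (walk_verts G u P)"
    by (auto; metis)
  have gE: "g \<in> edges G" using g(3) S_edges by blast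
  have sub: "set (ends G g) \<subseteq> set (walk_verts G u P)"
    using g(6) walk_verts_nonempty[of u G P] by auto
  show False
  proof (cases "length (ends G g) = 2")
    case False
    have "half_edge G g \<and> ends G g = [v]"
      by (rule edge_kinds[OF gE]) (use g(5) False in auto)
    then have "half_edge G g" "ends G g = [v]" by blast+
    then show False using no_handcuff_halves[OF assms(2) u assms(1), of g v P] g by auto
  next
    case True
    have gS: "g \<in> S" using g(3) by blast
    from finish_path[OF g(1) gS g(4) True g(5) sub] obtain A B x i
      where AB: "P = A @ B" "path_between G u A x" "path_between G x B v"
        "simple_cycle G x (B @ [(g, i)])" "set (walk_starts G (B @ [(g, i)])) = set (walk_verts G x B)"
        "set (walk_verts G u A) \<inter> set (walk_verts G x B) = {x}" by metis
    have vC: "verts G (walk_edges (B @ [(g, i)])) = set (walk_verts G x B)"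
      using simple_cycle_verts(1)[OF AB(4)] AB(5) by simp
    have "A = [] \<longleftrightarrow> u = x"
      using AB(2) by (cases A) (auto simp: path_between_def dest: walk_end_in_verts)
    then have "{u} \<inter> set (walk_verts G x B) = (if A = [] then {u} else {})"
      using AB(6) walk_verts_nonempty[of u G A] by auto
    then show False
      using no_handcuff_half_circle[OF assms(2) u assms(1) AB(4,2)] g(2,3) AB(1,6)
      by (auto simp: vC[simplified] Int_commute)
  qed
qed

text \<open>
  In a theta graph the product of the signs of the three cycles is positive, so they cannot all be
  negative.
\<close>

lemma theta_positive_cycle:
  assumes cyc: "simple_cycle G w (A @ B)" "walk_edges (A @ B) \<subseteq> S"
    and A: "walk G w A x" and B: "walk G x B w" and ne: "x \<noteq> w"
    and Q: "walk G w Q x" "walk_edges Q \<subseteq> S - walk_edges (A @ B)"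
      "distinct (walk_starts G Q)" "distinct (map fst Q)"
      "set (walk_starts G Q) \<inter> set (walk_starts G (A @ B)) = {w}"
  shows False
proof -
  have d: "distinct (walk_starts G (A @ B))" "distinct (map fst (A @ B))"
    using cyc(1) by (auto simp: simple_cycle_def)
  have AB: "A \<noteq> []" "B \<noteq> []" using A B ne by auto
  have wA: "w \<in> set (walk_starts G A)" using A AB(1) by (cases A) auto
  have xB: "x \<in> set (walk_starts G B)" using B AB(2) by (cases B) auto
  have vA: "walk_verts G w A = walk_starts G A @ [x]" using walk_verts_eq_starts[OF A] .
  \<comment> \<open>Reversal exchanges the role of the ends: the starts of the reversed
    \<open>A\<close> contain \<open>x\<close> but not \<open>w\<close>, so \<open>Q\<close>, which
    starts at \<open>w\<close>, can follow without a repetition.\<close>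
  have sA: "set (walk_starts G (rev_walk A)) \<subseteq> set (walk_starts G (A @ B))"
      "w \<notin> set (walk_starts G (rev_walk A))" "distinct (walk_starts G (rev_walk A))"
  proof -
    have e: "walk_starts G (rev_walk A) = rev (tl (walk_starts G A) @ [x])"
      using walk_starts_rev[OF A] vA AB(1) by (simp add: walk_starts_def)
    obtain as where as: "walk_starts G A = w # as" using A AB(1) by (cases A) auto
    show "set (walk_starts G (rev_walk A)) \<subseteq> set (walk_starts G (A @ B))"
      "w \<notin> set (walk_starts G (rev_walk A))" "distinct (walk_starts G (rev_walk A))"
      using e as xB d(1) ne by auto
  qed
  have c1: "simple_cycle G x (B @ Q)"
    using B Q d AB wA by (auto simp: simple_cycle_def walk_append walk_edges_def)
  have sAQ: "set (walk_starts G (rev_walk A)) \<inter> set (walk_starts G Q) = {}"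
  proof (rule equals0I)
    fix z assume z: "z \<in> set (walk_starts G (rev_walk A)) \<inter> set (walk_starts G Q)"
    then have "z \<in> set (walk_starts G Q) \<inter> set (walk_starts G (A @ B))" using sA(1) by blast
    then have "z = w" unfolding Q(5) by simp
    then show False using z sA(2) by blast
  qed
  have eAQ: "set (map fst (rev_walk A)) \<inter> set (map fst Q) = {}"
    using Q(2) by (auto simp: walk_edges_def)
  have "rev_walk A \<noteq> []" using AB(1) by (simp add: rev_walk_def)
  moreover have "walk G x (rev_walk A @ Q) x" using walk_rev[OF A] Q(1) by (auto simp: walk_append)
  moreover have "distinct (map fst (rev_walk A @ Q))"
    using eAQ d(2) Q(4) unfolding map_append distinct_append map_fst_rev_walk by simp
  ultimately have c2: "simple_cycle G x (rev_walk A @ Q)"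
    using sA(3) sAQ Q(3) by (simp add: simple_cycle_def)
  have "walk_sign G A * walk_sign G B = -1" "walk_sign G B * walk_sign G Q = -1"
    "walk_sign G A * walk_sign G Q = -1"
    using cycle_negative[OF cyc] cycle_negative[OF c1] cycle_negative[OF c2] Q(2) cyc(2) by auto
  moreover have "walk_sign G A = 1 \<or> walk_sign G A = -1" using walk_sign_cases[OF A] .
  ultimately show False by auto
qed

lemma contradiction: False
proof -
  have nh: "\<not> half_edge G e" if "e \<in> S" for e using no_half_edge that by blast
  have len: "length (ends G e) = 2" if "e \<in> S" for e
    using edge_kinds[of e] that nh[of e] no_loose[of e] S_edges
    by (metis One_nat_def Suc_1 length_Cons list.size(3) subsetD)
  obtain u\<^sub>0 W\<^sub>0 where W0: "simple_cycle G u\<^sub>0 W\<^sub>0" "walk_edges W\<^sub>0 \<subseteq> S" using cycle_exists nh by metis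
  define X where "X = set (walk_starts G W\<^sub>0)"
  have X: "X = verts G (walk_edges W\<^sub>0)" using simple_cycle_verts(1)[OF W0(1)] by (simp add: X_def)
  obtain g\<^sub>0 w\<^sub>0 where g0: "g\<^sub>0 \<in> S - walk_edges W\<^sub>0" "w\<^sub>0 \<in> X" "w\<^sub>0 \<in> set (ends G g\<^sub>0)"
    using edge_leaving_cycle[OF W0] by (auto simp: X_def)
  have NX: "\<And>e. e \<in> walk_edges W\<^sub>0 \<Longrightarrow> set (ends G e) \<subseteq> X" unfolding X verts_def by blast
  have "\<exists>g\<in>S - {p}. v \<in> set (ends G g)" if "p \<in> S" "v \<in> set (ends G p)" for p v
    using other_edge_at that .
  then have "\<exists>w P v g. w \<in> X \<and> path_between G w P v \<and> walk_edges P \<subseteq> S - walk_edges W\<^sub>0 \<and>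
    set (walk_verts G w P) \<inter> X = {w} \<and> g \<in> S - walk_edges W\<^sub>0 \<and> g \<notin> walk_edges P \<and>
    v \<in> set (ends G g) \<and> set (ends G g) \<subseteq> X \<union> set (walk_verts G w P)"
    using NX by (intro longest_path_edge[OF S_edges _ g0]) auto
  then obtain w P v g where g: "w \<in> X" "path_between G w P v" "walk_edges P \<subseteq> S - walk_edges W\<^sub>0"
    "set (walk_verts G w P) \<inter> X = {w}" "g \<in> S - walk_edges W\<^sub>0" "g \<notin> walk_edges P" "v \<in> set (ends G g)"
    "set (ends G g) \<subseteq> X \<union> set (walk_verts G w P)" by blast
  \<comment> \<open>The maximal path leaves the cycle at \<open>w\<close>, which need not be
    \<open>w\<^sub>0\<close>; the cycle is rotated to start there.\<close>
  obtain W where W: "simple_cycle G w W" "walk_edges W = walk_edges W\<^sub>0"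
    using simple_cycle_rotate_to[OF W0(1), of w] g(1) X_def by metis
  have sW: "set (walk_starts G W) = X" using simple_cycle_verts(1)[OF W(1)] W(2) X by simp
  have lg: "length (ends G g) = 2" and gS: "g \<in> S" using len g(5) by auto
  show False
  proof (cases "set (ends G g) \<subseteq> set (walk_verts G w P)")
    case True
    from finish_path[OF g(2) gS g(6) lg g(7) True] obtain A B x i
      where AB: "P = A @ B" "path_between G w A x" "path_between G x B v"
        "simple_cycle G x (B @ [(g, i)])" "set (walk_starts G (B @ [(g, i)])) = set (walk_verts G x B)"
        "set (walk_verts G w A) \<inter> set (walk_verts G x B) = {x}" by metis
    have vC: "verts G (walk_edges (B @ [(g, i)])) = set (walk_verts G x B)"
      using simple_cycle_verts(1)[OF AB(4)] AB(5) by simp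
    have Aw: "walk G w A x" using AB(2) by (simp add: path_between_def)
    have vP: "set (walk_verts G w P) = set (walk_verts G w A) \<union> set (walk_verts G x B)"
      using walk_verts_append[OF Aw, of B] walk_verts_eq_starts[OF Aw] AB(1)
        walk_verts_nonempty[of x G B] by auto
    have wA: "w \<in> set (walk_verts G w A)" using walk_verts_nonempty .
    have 1: "X \<inter> set (walk_verts G w A) = {w}" using g(4) vP wA by blast
    have A: "A = [] \<longleftrightarrow> w = x"
      using AB(2) by (cases A) (auto simp: path_between_def dest: walk_end_in_verts)
    have "X \<inter> set (walk_verts G x B) \<subseteq> {w}" using g(4) vP by blast
    moreover have "w \<in> set (walk_verts G x B) \<longleftrightarrow> w = x"
      using AB(6) wA walk_verts_nonempty[of x G B] by blast
    \<comment> \<open>The old cycle and the new one meet, namely in \<open>w\<close>, exactly when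
      the connecting path is empty, as \<open>handcuff\<close> demands.\<close>
    ultimately have 2: "X \<inter> set (walk_verts G x B) = (if A = [] then {w} else {})"
      using g(1) unfolding A by (cases "w = x") (simp_all, blast+)
    show False
      by (rule no_handcuff_circles[OF W(1) _ AB(4,2)])
        (use W0(2) W(2) g(3,5) AB(1,6) vC sW X 1 2 in \<open>auto simp: Int_commute\<close>)
  next
    \<comment> \<open>The last edge returns to the cycle at a vertex different from
      \<open>w\<close>; the path together with \<open>g\<close> is the third arc of a theta
      graph.\<close>
    case False
    obtain i where i: "i < 2" "ends G g ! i = v" using g(7) lg by (metis in_set_conv_nth)
    let ?x = "ends G g ! (1 - i)"
    have Pw: "walk G w P v" "distinct (walk_verts G w P)" using g(2) by (auto simp: path_between_def)
    have vP: "v \<in> set (walk_verts G w P)" using walk_end_in_verts[OF Pw(1)] .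
    have x: "?x \<in> X" "?x \<notin> set (walk_verts G w P)"
      using set_two_indexed[OF lg i(1)] i(2) False vP g(8) by auto
    have "?x \<noteq> w" using x(2) walk_verts_nonempty[of w G P] by auto
    have Ww: "walk G w W w" using W(1) by (simp add: simple_cycle_def)
    have "?x \<in> set (walk_verts G w W)" using simple_cycle_verts(3)[OF W(1)] sW x(1) by simp
    from walk_split[OF Ww this] obtain A B where AB: "W = A @ B" "walk G w A ?x" "walk G ?x B w"
      by blast
    have sP: "walk_starts G (P @ [(g, i)]) = walk_verts G w P"
      using walk_verts_eq_starts[OF Pw(1)] i(2) by simp
    show False
    proof (rule theta_positive_cycle[of w A B ?x "P @ [(g, i)]"])
      show "walk G w (P @ [(g, i)]) ?x" using Pw(1) i lg gS S_edges by (auto simp: walk_append)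
      show "distinct (map fst (P @ [(g, i)]))"
        using path_distinct_edges[OF Pw] g(6) by (auto simp: walk_edges_def)
      show "set (walk_starts G (P @ [(g, i)])) \<inter> set (walk_starts G (A @ B)) = {w}"
        using sP g(4) sW AB(1) by simp
      show "simple_cycle G w (A @ B)" "walk_edges (A @ B) \<subseteq> S" using W W0(2) AB(1) by simp_all
      show "walk_edges (P @ [(g, i)]) \<subseteq> S - walk_edges (A @ B)"
        using g(3,5) W(2) AB(1) by simp
      show "distinct (walk_starts G (P @ [(g, i)]))" using sP Pw(2) by simp
      show "walk G w A ?x" "walk G ?x B w" "?x \<noteq> w" by fact+
    qed
  qed
qed

end

text \<open>Hyperbalance passes to subsets, so an inclusion-minimal unsolvable subset of
  \<open>S\<close> would meet the refuted locale assumptions.\<close>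

lemma (in gain_graph) hyperbalanced_iff_solvable:
  assumes "S \<subseteq> edges G"
  shows "hyperbalanced G S \<longleftrightarrow> solvable G S"
proof
  assume hyp: "hyperbalanced G S"
  show "solvable G S"
  proof (rule ccontr)
    assume ns: "\<not> solvable G S"
    have fin: "finite S" using assms wf finite_subset by (auto simp: gain_signed_graph_def)
    let ?F = "{T. T \<subseteq> S \<and> \<not> solvable G T}"
    have "finite ?F" "S \<in> ?F" using fin ns by auto
    then obtain T where T: "T \<in> ?F" "\<forall>U\<in>?F. U \<subseteq> T \<longrightarrow> T = U"
      using finite_has_minimal2[of ?F S] by blast
    interpret minimal_unsolvable G T
    proof
      show "hyperbalanced G T" using hyp T(1) by (auto simp: hyperbalanced_def)
      show "solvable G (T - {p})" if "p \<in> T" for p using T that by blast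
    qed (use T assms in auto)
    show False by (rule contradiction)
  qed
qed (rule solvable_hyperbalanced)

section \<open>Balanced components and the dimension of the solution space\<close>

lemma connected_in_refl: "connected_in G S u u"
  unfolding connected_in_def by (rule exI[of _ "[]"]) simp

lemma connected_in_sym: "connected_in G S u v \<Longrightarrow> connected_in G S v u"
  unfolding connected_in_def using walk_rev walk_edges_rev by metis

lemma connected_in_trans: "connected_in G S u v \<Longrightarrow> connected_in G S v w \<Longrightarrow> connected_in G S u w"
  unfolding connected_in_def by (metis Un_least walk_append walk_edges_simps(3))

lemma connected_in_edge:
  assumes "e \<in> S" "e \<in> edges G" "ends G e = [a, b]"
  shows "connected_in G S a b"
  unfolding connected_in_def by (rule exI[of _ "[(e, 0)]"]) (use assms in auto)

lemma equiv_connected: "equiv UNIV {(u, v). connected_in G S u v}"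
  by (rule equivI)
    (auto simp: refl_on_def sym_on_def trans_on_def
      intro: connected_in_refl connected_in_sym connected_in_trans)

lemma component_connected:
  assumes "X \<in> components_of G S" "u \<in> X"
  shows "v \<in> X \<longleftrightarrow> connected_in G S u v"
proof -
  obtain x where x: "X = {(u, v). connected_in G S u v} `` {x}"
    using assms(1) unfolding components_of_def by (rule quotientE)
  then have "connected_in G S x u" using assms(2) by simp
  then show ?thesis using x connected_in_trans connected_in_sym by fast
qed

lemma component_eqI:
  "X \<in> components_of G S \<Longrightarrow> Y \<in> components_of G S \<Longrightarrow> v \<in> X \<Longrightarrow> v \<in> Y \<Longrightarrow> X = Y"
  using component_connected[of X G S v] component_connected[of Y G S v] by blast

lemma component_nonempty: "X \<in> components_of G S \<Longrightarrow> X \<noteq> {}"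
  unfolding components_of_def using in_quotient_imp_non_empty[OF equiv_connected] by blast

lemma component_exists: "\<exists>X\<in>components_of G S. v \<in> X"
  unfolding components_of_def
  by (rule bexI[OF _ quotientI[of v]]) (simp_all add: connected_in_refl)

lemma prod_list_count:
  fixes f :: "'v::finite \<Rightarrow> int"
  shows "(\<Prod>x\<leftarrow>xs. f x) = (\<Prod>v\<in>UNIV. f v ^ count_list xs v)"
proof (induction xs)
  case (Cons x xs)
  have "(\<Prod>v\<in>UNIV. f v ^ count_list (x # xs) v) =
    (\<Prod>v\<in>UNIV. (if x = v then f v else 1) * f v ^ count_list xs v)"
    by (rule prod.cong) auto
  then show ?case using Cons by (simp add: prod.distrib)
qed auto

text \<open>Regrouped by vertices, the product contains each \<open>\<eta> v\<close> to the power of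
  its degree, which is two on the circle. Counting degrees handles loops as well and avoids choosing
  a walk around the circle.\<close>

lemma circle_sign_switching:
  fixes G :: "('v::finite, 'e, 'k) gsgraph"
  assumes "circle G C" and \<eta>: "\<And>v. v \<in> verts G C \<Longrightarrow> \<eta> v = 1 \<or> \<eta> v = -1"
    and e: "\<And>e. e \<in> C \<Longrightarrow> esign G e = \<eta> (ends G e ! 0) * \<eta> (ends G e ! 1)"
  shows "(\<Prod>e\<in>C. esign G e) = 1"
proof -
  have "(\<Prod>e\<in>C. esign G e) = (\<Prod>e\<in>C. \<Prod>v\<leftarrow>ends G e. \<eta> v)"
  proof (rule prod.cong)
    fix f assume f: "f \<in> C"
    then have "length (ends G f) = 2" using assms(1) by (simp add: circle_def)
    then obtain a b where "ends G f = [a, b]" by (auto simp: length_Suc_conv numeral_2_eq_2)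
    then show "esign G f = (\<Prod>v\<leftarrow>ends G f. \<eta> v)" using e[OF f] by simp
  qed simp
  also have "\<dots> = (\<Prod>v\<in>UNIV. \<Prod>e\<in>C. \<eta> v ^ count_list (ends G e) v)"
    unfolding prod_list_count by (rule prod.swap)
  also have "\<dots> = (\<Prod>v\<in>UNIV. \<eta> v ^ degree_in G C v)"
    by (simp add: power_sum degree_in_def)
  also have "\<dots> = 1"
  proof (rule prod.neutral, rule ballI)
    fix v
    show "\<eta> v ^ degree_in G C v = 1"
    proof (cases "v \<in> verts G C")
      case True
      then have "degree_in G C v = 2" using assms(1) by (simp add: circle_def)
      then show ?thesis using \<eta>[OF True] by auto
    next
      case False
      then have "degree_in G C v = 0"
        by (auto simp: verts_def degree_in_def count_list_0_iff intro!: sum.neutral)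
      then show ?thesis by simp
    qed
  qed
  finally show ?thesis .
qed

context gain_graph
begin

lemma walk_homogeneous:
  "walk G u W v \<Longrightarrow> \<forall>e\<in>walk_edges W. edge_eval G 0 y e = 0 \<Longrightarrow> y u = of_int (walk_sign G W) * y v"
proof (induction W arbitrary: u)
  case (Cons s W)
  obtain e i where s: "s = (e, i)" by fastforce
  have w: "walk G (ends G e ! (1 - i)) W v" "e \<in> edges G" "length (ends G e) = 2" "i < 2"
    "ends G e ! i = u"
    using Cons.prems(1) s by auto
  have "y u = of_int (esign G e) * y (ends G e ! (1 - i))"
    using edge_eval_step_zero_iff[OF w(2-4), of y] w(5) Cons.prems(2) s by simp
  then show ?case using Cons.IH[OF w(1)] Cons.prems(2) s by simp
qed auto

text \<open>The sign is that of a chosen walk and therefore the same for all \<open>y\<close>; this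
  uniformity makes any two homogeneous solutions comparable on a component.\<close>

lemma connected_homogeneous:
  assumes "connected_in G S u v"
  obtains s where "s = 1 \<or> s = -1"
    "\<And>y. \<forall>e\<in>S. edge_eval G 0 y e = 0 \<Longrightarrow> y u = s * y v"
proof -
  obtain W where W: "walk G u W v" "walk_edges W \<subseteq> S" using assms by (auto simp: connected_in_def)
  have "of_int (walk_sign G W) = (1::'k) \<or> of_int (walk_sign G W) = (-1::'k)"
    using walk_sign_cases[OF W(1)] by auto
  moreover have "y u = of_int (walk_sign G W) * y v"
    if "\<forall>e\<in>S. edge_eval G 0 y e = 0" for y :: "'v \<Rightarrow> 'k"
    by (rule walk_homogeneous[OF W(1)]) (use that W(2) in blast)
  ultimately show ?thesis by (rule that)
qed

text \<open>Edges are added one at a time. If the ends of \<open>e\<close> are already connected,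
  \<open>e\<close> closes a cycle, positive by balance, and the old function satisfies its equation;
  otherwise the function may be flipped on one of the two components.\<close>

lemma switching_function:
  assumes "finite T" "T \<subseteq> edges G" "sign_balanced G T"
  shows "\<exists>\<eta> :: 'v \<Rightarrow> int. (\<forall>v. \<eta> v = 1 \<or> \<eta> v = -1) \<and>
    (\<forall>e\<in>T. length (ends G e) = 2 \<longrightarrow> \<eta> (ends G e ! 0) = esign G e * \<eta> (ends G e ! 1))"
  using assms
proof (induction T rule: finite_induct)
  case empty
  show ?case by (rule exI[of _ "\<lambda>_. 1"]) simp
next
  case (insert e F)
  have "sign_balanced G F" using insert.prems(2) by (auto simp: sign_balanced_def)
  then obtain \<eta> :: "'v \<Rightarrow> int" where \<eta>: "\<And>v. \<eta> v = 1 \<or> \<eta> v = -1"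
    "\<And>f. f \<in> F \<Longrightarrow> length (ends G f) = 2 \<Longrightarrow> \<eta> (ends G f ! 0) = esign G f * \<eta> (ends G f ! 1)"
    using insert by blast
  have eE: "e \<in> edges G" using insert.prems by simp
  show ?case
  proof (cases "length (ends G e) = 2")
    case False
    then show ?thesis using \<eta> by (intro exI[of _ \<eta>]) auto
  next
    case True
    then obtain a b where ab: "ends G e = [a, b]" by (auto simp: length_Suc_conv numeral_2_eq_2)
    show ?thesis
    proof (cases "connected_in G F b a")
      case True
      then obtain W where "walk G b W a" "walk_edges W \<subseteq> F" by (auto simp: connected_in_def)
      then obtain P where P: "path_between G b P a" "walk_edges P \<subseteq> F"
        using shortcut_path[of G b W a] by blast
      have wP: "walk G b P a" using P(1) by (simp add: path_between_def)
      have cyc: "simple_cycle G b (P @ [(e, 0)])"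
        by (rule path_closing_edge[OF P(1) eE]) (use ab P(2) insert.hyps(2) in auto)
      have "\<not> negative_circle G (walk_edges (P @ [(e, 0)]))"
        using insert.prems(2) insert_mono[OF P(2), of e] unfolding sign_balanced_def by simp
      then have "walk_sign G (P @ [(e, 0)]) \<noteq> -1"
        using simple_cycle_circle[OF cyc] prod_walk_sign[of "P @ [(e, 0)]" G] cyc
        by (auto simp: negative_circle_def simple_cycle_def)
      then have "walk_sign G P * esign G e = 1"
        using walk_sign_cases[of b "P @ [(e, 0)]" b] cyc by (auto simp: simple_cycle_def)
      moreover have "walk G u Q v \<Longrightarrow> walk_edges Q \<subseteq> F \<Longrightarrow> \<eta> u = walk_sign G Q * \<eta> v" for u Q v
      proof (induction Q arbitrary: u)
        case (Cons s Q)
        obtain f i where s: "s = (f, i)" by fastforce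
        have w: "walk G (ends G f ! (1 - i)) Q v" "f \<in> edges G" "length (ends G f) = 2" "i < 2"
          "ends G f ! i = u" "f \<in> F"
          using Cons.prems s by auto
        have "i = 0 \<or> i = 1" using w(4) by auto
        then have "\<eta> u = esign G f * \<eta> (ends G f ! (1 - i))"
          using \<eta>(2)[OF w(6,3)] w(5) esign_cases[OF w(2)] by auto
        then show ?case using Cons.IH[OF w(1)] Cons.prems(2) s by simp
      qed simp
      ultimately have "\<eta> a = esign G e * \<eta> b"
        using P(2) wP esign_cases[OF eE] walk_sign_cases[OF wP] by fastforce
      then show ?thesis using \<eta> ab by (intro exI[of _ \<eta>]) auto
    next
      case False
      \<comment> \<open>The factor gives \<open>b\<close> the value
        \<open>esign G e * \<eta> a\<close>; being constant on the component of \<open>b\<close>, it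
        disturbs no edge of \<open>F\<close>.\<close>
      define \<theta> where "\<theta> = (\<lambda>x. if connected_in G F b x then esign G e * \<eta> a * \<eta> b * \<eta> x else \<eta> x)"
      have "\<theta> v = 1 \<or> \<theta> v = -1" for v
        using esign_cases[OF eE] \<eta>(1)[of a] \<eta>(1)[of b] \<eta>(1)[of v] by (auto simp: \<theta>_def)
      moreover have "\<theta> (ends G f ! 0) = esign G f * \<theta> (ends G f ! 1)"
        if f: "f \<in> insert e F" "length (ends G f) = 2" for f
      proof (cases "f = e")
        case True
        then show ?thesis using ab False esign_cases[OF eE] \<eta>(1)[of b]
          by (auto simp: \<theta>_def connected_in_refl)
      next
        case False
        then have fF: "f \<in> F" using f by simp
        obtain c d where cd: "ends G f = [c, d]" using f(2) by (auto simp: length_Suc_conv numeral_2_eq_2)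
        have "connected_in G F c d" using connected_in_edge[OF fF _ cd] fF insert.prems by auto
        then have "connected_in G F b c \<longleftrightarrow> connected_in G F b d"
          using connected_in_trans connected_in_sym by metis
        then show ?thesis using \<eta>(2)[OF fF f(2)] cd by (auto simp: \<theta>_def)
      qed
      ultimately show ?thesis by blast
    qed
  qed
qed

text \<open>An edge of \<open>S\<close> has all its ends in \<open>X\<close> or none, so extending a
  switching function by zero violates no equation; balance excludes half edges at
  \<open>X\<close>.\<close>

lemma balanced_component_function:
  assumes S: "S \<subseteq> edges G" and X: "X \<in> components_of G S"
    and bal: "sign_balanced G (component_edges G S X)"
  shows "\<exists>y :: 'v \<Rightarrow> 'k. (\<forall>e\<in>S. edge_eval G 0 y e = 0) \<and> (\<forall>v\<in>X. y v = 1 \<or> y v = -1) \<and>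
    (\<forall>v. v \<notin> X \<longrightarrow> y v = 0)"
proof -
  have T: "component_edges G S X \<subseteq> edges G" "finite (component_edges G S X)"
    using S wf finite_subset[of _ "edges G"] by (auto simp: component_edges_def gain_signed_graph_def)
  obtain \<eta> :: "'v \<Rightarrow> int" where \<eta>: "\<And>v. \<eta> v = 1 \<or> \<eta> v = -1"
    "\<And>f. f \<in> component_edges G S X \<Longrightarrow> length (ends G f) = 2 \<Longrightarrow>
      \<eta> (ends G f ! 0) = esign G f * \<eta> (ends G f ! 1)"
    using switching_function[OF T(2,1) bal] by blast
  define y :: "'v \<Rightarrow> 'k" where "y = (\<lambda>v. if v \<in> X then of_int (\<eta> v) else 0)"
  have "edge_eval G 0 y e = 0" if e: "e \<in> S" for e
  proof -
    have eE: "e \<in> edges G" using e S by blast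
    show ?thesis
    proof (rule edge_kinds[OF eE])
      assume "ends G e = []"
      then show ?thesis by (simp add: edge_eval_def)
    next
      fix v assume v: "half_edge G e" "ends G e = [v]"
      then have "e \<notin> component_edges G S X" using bal by (auto simp: sign_balanced_def)
      then have "v \<notin> X" using e v by (auto simp: component_edges_def loose_edge_def)
      then show ?thesis using v by (simp add: edge_eval_half y_def)
    next
      fix a b assume ab: "ends G e = [a, b]"
      have conn: "connected_in G S a b" by (rule connected_in_edge[OF e eE ab])
      then have iff: "a \<in> X \<longleftrightarrow> b \<in> X"
        using component_connected[OF X, of a b] component_connected[OF X, of b a]
          connected_in_sym[OF conn] by blast
      have "y a = of_int (esign G e) * y b"
      proof (cases "a \<in> X")
        case True
        then have "e \<in> component_edges G S X" using e ab iff
          by (auto simp: component_edges_def loose_edge_def)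
        then show ?thesis using \<eta>(2)[of e] ab True iff by (simp add: y_def)
      qed (use iff in \<open>simp add: y_def\<close>)
      then show ?thesis using edge_eval_step_zero_iff[OF eE, of 0 y] ab by simp
    qed
  qed
  moreover have "\<forall>v\<in>X. y v = 1 \<or> y v = -1" using \<eta>(1) by (auto simp: y_def) (metis of_int_1 of_int_minus)+
  ultimately show ?thesis by (intro exI[of _ y]) (simp add: y_def)
qed

text \<open>On the component \<open>y\<close> takes only the values \<open>y u\<close> and
  \<open>- y u\<close>, which differ since 2 is nonzero. Their pattern is a switching function, so
  every circle is positive; a half edge would force the value zero.\<close>

lemma nonzero_component_balanced:
  assumes S: "S \<subseteq> edges G" and X: "X \<in> components_of G S" and u: "u \<in> X" "y u \<noteq> 0"
    and y: "\<forall>e\<in>S. edge_eval G 0 y e = 0"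
  shows "sign_balanced G (component_edges G S X)"
proof -
  have pm: "y w = y u \<or> y w = - y u" if "w \<in> X" for w
  proof -
    have "connected_in G S u w" using component_connected[OF X u(1)] that by simp
    then obtain s where "s = 1 \<or> s = -1" "y u = s * y w" using connected_homogeneous y by metis
    then show ?thesis by auto
  qed
  have ne: "y u \<noteq> - y u"
  proof
    assume "y u = - y u"
    then have "2 * y u = 0" by (metis add.right_inverse mult_2)
    then show False using char u(2) by simp
  qed
  have "\<not> half_edge G e" if e: "e \<in> component_edges G S X" for e
  proof
    assume h: "half_edge G e"
    then obtain v where v: "ends G e = [v]" by (auto simp: half_edge_def length_Suc_conv)
    have "v \<in> X" "e \<in> S" "e \<in> edges G" using e v S by (auto simp: component_edges_def)
    then have "y v = 0" using y orient_nonzero[of e 0] v by (auto simp: edge_eval_half[OF v])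
    then show False using pm[OF \<open>v \<in> X\<close>] u(2) by auto
  qed
  moreover have "\<not> negative_circle G C" if C: "C \<subseteq> component_edges G S X" for C
  proof
    assume nc: "negative_circle G C"
    define \<eta> :: "'v \<Rightarrow> int" where "\<eta> = (\<lambda>w. if y w = y u then 1 else -1)"
    have "(\<Prod>e\<in>C. esign G e) = 1"
    proof (rule circle_sign_switching)
      show "circle G C" using nc by (simp add: negative_circle_def)
      show "\<eta> v = 1 \<or> \<eta> v = -1" for v by (simp add: \<eta>_def)
      fix e assume e: "e \<in> C"
      then have "length (ends G e) = 2" using nc by (simp add: negative_circle_def circle_def)
      then obtain a b where ab: "ends G e = [a, b]" by (auto simp: length_Suc_conv numeral_2_eq_2)
      have "e \<in> component_edges G S X" using e C by blast
      then have eS: "e \<in> S" "e \<in> edges G" "a \<in> X" "b \<in> X" using S ab by (auto simp: component_edges_def)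
      then have "y a = of_int (esign G e) * y b"
        using edge_eval_step_zero_iff[of e 0 y] y ab by simp
      then show "esign G e = \<eta> (ends G e ! 0) * \<eta> (ends G e ! 1)"
        using pm[OF eS(3)] pm[OF eS(4)] ne esign_cases[OF eS(2)] ab by (auto simp: \<eta>_def)
    qed
    then show False using nc by (simp add: negative_circle_def)
  qed
  ultimately show ?thesis by (auto simp: sign_balanced_def)
qed

section \<open>The solution space and its dimension\<close>

definition sol_space :: "'e set \<Rightarrow> ('k ^ 'v option) set" where
  "sol_space S = {y. \<forall>e\<in>S. scalar_product (edge_vector G e) y = 0}"

lemma scalar_product_edge_vector:
  "scalar_product (edge_vector G e) y = edge_eval G (y $ None) (\<lambda>v. y $ Some v) e"
proof -
  have sp: "scalar_product (axis i 1) y = y $ i" for i :: "'v option"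
    by (simp add: scalar_product_def axis_def if_distrib[of "\<lambda>x. x * _"] cong: if_cong)
  have add: "scalar_product (a + b) y = scalar_product a y + scalar_product b y" for a b :: "'k ^ 'v option"
    by (simp add: scalar_product_def algebra_simps sum.distrib)
  have scale: "scalar_product (c *s a) y = c * scalar_product a y" for c and a :: "'k ^ 'v option"
    by (simp add: scalar_product_def algebra_simps sum_distrib_left)
  have zero: "scalar_product (0 :: 'k ^ 'v option) y = 0" by (simp add: scalar_product_def)
  have sum: "scalar_product (\<Sum>i<n. f i) y = (\<Sum>i<n. scalar_product (f i) y)"
    for f :: "nat \<Rightarrow> 'k ^ 'v option" and n :: nat
    by (induction n) (simp_all add: add zero)
  show ?thesis by (simp add: edge_vector_def edge_eval_def add sum scale sp)
qed

lemma sol_space_eval: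
  "sol_space S = {y. \<forall>e\<in>S. edge_eval G (y $ None) (\<lambda>v. y $ Some v) e = 0}"
  by (simp add: sol_space_def scalar_product_edge_vector)

lemma subspace_sol_space: "vec.subspace (sol_space S)"
proof -
  have "scalar_product z (a + b) = scalar_product z a + scalar_product z b" for z a b :: "'k ^ 'v option"
    by (simp add: scalar_product_def algebra_simps sum.distrib)
  moreover have "scalar_product z (c *s a) = c * scalar_product z a" for c and z a :: "'k ^ 'v option"
    by (simp add: scalar_product_def algebra_simps sum_distrib_left)
  moreover have "scalar_product z 0 = 0" for z :: "'k ^ 'v option" by (simp add: scalar_product_def)
  ultimately show ?thesis by (auto simp: sol_space_def vec.subspace_def)
qed

lemma subspace_homogeneous: "vec.subspace {y \<in> sol_space S. y $ None = 0}"
  using subspace_sol_space[of S] by (auto simp: vec.subspace_def)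

lemma span_homogeneous: "vec.span {y \<in> sol_space S. y $ None = 0} = {y \<in> sol_space S. y $ None = 0}"
  by (rule vec.span_eq_iff[THEN iffD2, OF subspace_homogeneous])

lemma dim_homogeneous:
  assumes S: "S \<subseteq> edges G"
  shows "vec.dim {y \<in> sol_space S. y $ None = 0} = balanced_components G S"
proof -
  let ?C = "{X \<in> components_of G S. sign_balanced G (component_edges G S X)}"
  let ?H = "\<lambda>y :: 'v \<Rightarrow> 'k. \<forall>e\<in>S. edge_eval G 0 y e = 0"
  have "\<forall>X\<in>?C. \<exists>y :: 'v \<Rightarrow> 'k. ?H y \<and> (\<forall>v\<in>X. y v = 1 \<or> y v = -1) \<and> (\<forall>v. v \<notin> X \<longrightarrow> y v = 0)"
    using balanced_component_function[OF S] by blast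
  then obtain z :: "'v set \<Rightarrow> 'v \<Rightarrow> 'k" where z0: "\<forall>X\<in>?C. ?H (z X) \<and>
      (\<forall>v\<in>X. z X v = 1 \<or> z X v = -1) \<and> (\<forall>v. v \<notin> X \<longrightarrow> z X v = 0)"
    by (rule bchoice[THEN exE])
  have z: "?H (z X)" "v \<in> X \<Longrightarrow> z X v = 1 \<or> z X v = -1" "v \<notin> X \<Longrightarrow> z X v = 0"
    if "X \<in> ?C" for X v using z0 that by blast+
  define b :: "'v set \<Rightarrow> 'k ^ 'v option" where
    "b X = (\<chi> i. case i of None \<Rightarrow> 0 | Some v \<Rightarrow> z X v)" for X
  have b_simps: "b X $ None = 0" "b X $ Some v = z X v" for X v by (simp_all add: b_def)
  have finC: "finite ?C" by (rule finite_subset[of _ UNIV]) auto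
  have inj: "inj_on b ?C"
  proof (rule inj_onI)
    fix X Y assume X: "X \<in> ?C" and Y: "Y \<in> ?C" and eq: "b X = b Y"
    obtain v where v: "v \<in> X" using component_nonempty X by blast
    have "z X v = z Y v" unfolding b_simps(2)[symmetric] eq ..
    then have "z Y v \<noteq> 0" using z(2)[OF X v] by auto
    then have "v \<in> Y" using z(3)[OF Y] by blast
    moreover have "X \<in> components_of G S" "Y \<in> components_of G S" using X Y by simp_all
    ultimately show "X = Y" using component_eqI[of X G S Y v] v by simp
  qed
  show ?thesis unfolding balanced_components_def
  proof (rule vec.dim_unique)
    show "b ` ?C \<subseteq> {y \<in> sol_space S. y $ None = 0}"
      using z(1) by (auto simp: sol_space_eval b_simps)
    show "card (b ` ?C) = card ?C" by (rule card_image[OF inj])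
    show "{y \<in> sol_space S. y $ None = 0} \<subseteq> vec.span (b ` ?C)"
    proof
      fix y assume y: "y \<in> {y \<in> sol_space S. y $ None = 0}"
      then have Hy: "?H (\<lambda>v. y $ Some v)" and y0: "y $ None = 0" by (auto simp: sol_space_eval)
      define r where "r X = (SOME v. v \<in> X)" for X :: "'v set"
      have r: "r X \<in> X" if "X \<in> ?C" for X
        using component_nonempty that some_in_eq unfolding r_def by blast
      \<comment> \<open>The value of \<open>z X\<close> at the representative is its own inverse, so
        this coefficient matches \<open>y\<close> at \<open>r X\<close>; the common sign from
        \<open>connected_homogeneous\<close> carries the agreement over the whole component.\<close>
      have "y = (\<Sum>X\<in>?C. (z X (r X) * y $ Some (r X)) *s b X)" (is "_ = ?s")
      proof (rule vec_eq_iff[THEN iffD2], rule allI)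
        fix i :: "'v option"
        show "y $ i = ?s $ i"
        proof (cases i)
          case None
          then show ?thesis using y0 by (simp add: b_simps)
        next
          case (Some v)
          obtain X where X: "X \<in> components_of G S" "v \<in> X" using component_exists[of G S v] by blast
          have other: "z Y v = 0" if "Y \<in> ?C - {X}" for Y
            using z(3)[of Y v] component_eqI[of Y G S X v] X that by blast
          have s: "?s $ i = (\<Sum>Y\<in>?C. z Y (r Y) * y $ Some (r Y) * z Y v)"
            by (simp add: Some b_simps)
          show ?thesis
          proof (cases "X \<in> ?C")
            case True
            have "(\<Sum>Y\<in>?C - {X}. z Y (r Y) * y $ Some (r Y) * z Y v) = 0"
              using other by (intro sum.neutral) simp
            then have "?s $ i = z X (r X) * y $ Some (r X) * z X v"
              unfolding s
              using sum.remove[OF finC True, of "\<lambda>Y. z Y (r Y) * y $ Some (r Y) * z Y v"] by simp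
            moreover have conn: "connected_in G S v (r X)"
              using component_connected[OF X] r[OF True] by blast
            from conn obtain s where s: "s = 1 \<or> s = -1"
              "\<And>x :: 'v \<Rightarrow> 'k. ?H x \<Longrightarrow> x v = s * x (r X)"
              by (rule connected_homogeneous) blast
            moreover have "y $ Some v = s * y $ Some (r X)" "z X v = s * z X (r X)"
              using s(2)[OF Hy] s(2)[OF z(1)[OF True]] by simp_all
            ultimately show ?thesis using s(1) z(2)[OF True r[OF True]] Some by auto
          next
            case False
            then have "y $ Some v = 0"
              using nonzero_component_balanced[OF S X, of "\<lambda>v. y $ Some v"] Hy X(1) by blast
            moreover have "z Y v = 0" if "Y \<in> ?C" for Y
              using other[of Y] that False by blast
            then have "?s $ i = 0" unfolding s by simp
            ultimately show ?thesis using Some by simp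
          qed
        qed
      qed
      also have "\<dots> \<in> vec.span (b ` ?C)"
        by (intro vec.span_sum vec.span_scale vec.span_base imageI)
      finally show "y \<in> vec.span (b ` ?C)" .
    qed
    show "vec.independent (b ` ?C)"
    proof
      assume "vec.dependent (b ` ?C)"
      then obtain u where u: "\<exists>w\<in>b ` ?C. u w \<noteq> 0" "(\<Sum>w\<in>b ` ?C. u w *s w) = 0"
        using vec.dependent_finite[of "b ` ?C"] finC by auto
      then obtain X where X: "X \<in> ?C" "u (b X) \<noteq> 0" by blast
      obtain v where v: "v \<in> X" using component_nonempty X(1) by blast
      have other: "z Y v = 0" if "Y \<in> ?C - {X}" for Y
        using z(3)[of Y v] component_eqI[of Y G S X v] X v that by blast
      have "(\<Sum>Y\<in>?C. u (b Y) *s b Y) = 0" using u(2) by (simp add: sum.reindex[OF inj])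
      \<comment> \<open>Components are disjoint, so the coordinate at a vertex of \<open>X\<close>
        isolates the coefficient of \<open>b X\<close>.\<close>
      then have "(\<Sum>Y\<in>?C. u (b Y) *s b Y) $ Some v = 0" by simp
      then have "(\<Sum>Y\<in>?C. u (b Y) * z Y v) = 0" by (simp add: b_simps)
      moreover have "(\<Sum>Y\<in>?C - {X}. u (b Y) * z Y v) = 0"
        using other by (intro sum.neutral) simp
      ultimately have "u (b X) * z X v = 0"
        using sum.remove[OF finC X(1), of "\<lambda>Y. u (b Y) * z Y v"] by simp
      then show False using X(2) z(2)[OF X(1) v] by auto
    qed
  qed
qed

lemma homogenize_in_sol_space:
  "homogenize x \<in> sol_space S \<longleftrightarrow> (\<forall>e\<in>S. edge_eval G 1 (\<lambda>v. x $ v) e = 0)"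
  by (simp add: sol_space_eval homogenize_def)

lemma solvable_iff_homogenize: "solvable G S \<longleftrightarrow> (\<exists>x. homogenize x \<in> sol_space S)"
  unfolding homogenize_in_sol_space solvable_def
proof
  assume "\<exists>x. \<forall>e\<in>S. edge_eval G 1 x e = 0"
  then obtain x where "\<forall>e\<in>S. edge_eval G 1 x e = 0" by blast
  moreover have "($) (\<chi> v. x v) = x" by (rule ext) simp
  ultimately show "\<exists>x. \<forall>e\<in>S. edge_eval G 1 (($) x) e = 0" by metis
qed blast

lemma scale_to_homogenize:
  fixes y :: "'k ^ 'v option"
  assumes "y $ None \<noteq> 0"
  shows "y = y $ None *s homogenize (\<chi> v. y $ Some v / y $ None)"
  using assms by (auto simp: vec_eq_iff homogenize_def split: option.split)

lemma dim_sol_space: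
  assumes S: "S \<subseteq> edges G"
  shows "vec.dim (sol_space S) = balanced_components G S + (if hyperbalanced G S then 1 else 0)"
proof -
  let ?W\<^sub>0 = "{y \<in> sol_space S. y $ None = 0}"
  show ?thesis
  proof (cases "solvable G S")
    case True
    then obtain x where x: "homogenize x \<in> sol_space S" using solvable_iff_homogenize by blast
    have nin: "homogenize x \<notin> vec.span ?W\<^sub>0"
      unfolding span_homogeneous by (simp add: homogenize_def)
    have "sol_space S \<subseteq> vec.span (insert (homogenize x) ?W\<^sub>0)"
    proof
      fix y assume y: "y \<in> sol_space S"
      have "y - y $ None *s homogenize x \<in> sol_space S"
        using y x subspace_sol_space by (intro vec.subspace_diff vec.subspace_scale)
      then have "y - y $ None *s homogenize x \<in> vec.span (insert (homogenize x) ?W\<^sub>0)"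
        by (intro vec.span_base) (simp add: homogenize_def)
      moreover have "y $ None *s homogenize x \<in> vec.span (insert (homogenize x) ?W\<^sub>0)"
        by (intro vec.span_scale vec.span_base) simp
      ultimately show "y \<in> vec.span (insert (homogenize x) ?W\<^sub>0)"
        by (rule vec.span_add[of "y - y $ None *s homogenize x" _ "y $ None *s homogenize x", simplified])
    qed
    from vec.dim_subset[OF this]
    have "vec.dim (sol_space S) \<le> vec.dim (insert (homogenize x) ?W\<^sub>0)"
      by (simp only: vec.dim_span)
    moreover have "vec.dim (insert (homogenize x) ?W\<^sub>0) \<le> vec.dim (sol_space S)"
      using x by (intro vec.dim_subset) auto
    ultimately have "vec.dim (sol_space S) = vec.dim ?W\<^sub>0 + 1"
      using vec.dim_insert[of "homogenize x" ?W\<^sub>0] nin by simp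
    then show ?thesis using dim_homogeneous[OF S] hyperbalanced_iff_solvable[OF S] True by simp
  next
    case False
    \<comment> \<open>A solution with nonzero coordinate \<open>None\<close> could be rescaled to
      one with coordinate 1, which would solve \<open>S\<close>.\<close>
    have "y $ None = 0" if y: "y \<in> sol_space S" for y
    proof (rule ccontr)
      assume n: "y $ None \<noteq> 0"
      have "homogenize (\<chi> v. y $ Some v / y $ None) = inverse (y $ None) *s y"
        by (subst (4) scale_to_homogenize[OF n]) (use n in \<open>simp add: vector_smult_assoc\<close>)
      also have "\<dots> \<in> sol_space S" using y subspace_sol_space by (intro vec.subspace_scale)
      finally show False using False solvable_iff_homogenize by blast
    qed
    then have "sol_space S = ?W\<^sub>0" by blast
    then show ?thesis using dim_homogeneous[OF S] hyperbalanced_iff_solvable[OF S] False by simp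
  qed
qed

text \<open>The rank uses truncated subtraction of naturals, so this bound is needed before it can
  be computed with. The vector \<open>axis None 1\<close> is independent of the homogeneous
  solutions, which leaves them dimension at most n.\<close>

lemma balanced_components_le:
  assumes "S \<subseteq> edges G"
  shows "balanced_components G S \<le> CARD('v)"
proof -
  let ?W\<^sub>0 = "{y \<in> sol_space S. y $ None = 0}"
  have "axis None 1 \<notin> vec.span ?W\<^sub>0"
    unfolding span_homogeneous by (simp add: axis_def)
  then have "vec.dim ?W\<^sub>0 + 1 = vec.dim (insert (axis None 1) ?W\<^sub>0)"
    by (simp add: vec.dim_insert)
  also have "\<dots> \<le> CARD('v option)"
    by (rule dim_subset_UNIV_cart_gen)
  finally show ?thesis by (simp add: dim_homogeneous[OF assms])
qed

text \<open>The extra 1 in the rank appears exactly when the extra 1 in the dimension does not, so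
  the rank is the codimension of the solution space.\<close>

lemma rank_plus_dim:
  assumes "S \<subseteq> edges G"
  shows "rk (gain_matroid G) S + vec.dim (sol_space S) = CARD('v option)"
  using dim_sol_space[OF assms] balanced_components_le[OF assms] by (simp add: gain_matroid_def)

end

section \<open>Order-reversing bijections of set families\<close>

text \<open>The meet is some greatest lower bound picked by choice; antisymmetry makes the pick
  unique and hence computable.\<close>

lemma (in partial_order) meet_eqI:
  assumes "greatest L s (Lower L {x, y})"
  shows "x \<sqinter>\<^bsub>L\<^esub> y = s"
  unfolding meet_def inf_def
proof (rule some_equality, rule assms)
  fix t assume "greatest L t (Lower L {x, y})"
  with assms have "t \<sqsubseteq> s" "s \<sqsubseteq> t" "s \<in> carrier L" "t \<in> carrier L"
    using greatest_closed[OF assms] by (simp_all add: greatest_def subset_iff)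
  then show "t = s" by (simp add: le_antisym)
qed

lemma (in partial_order) join_eqI:
  assumes "least L s (Upper L {x, y})"
  shows "x \<squnion>\<^bsub>L\<^esub> y = s"
  unfolding join_def sup_def
proof (rule some_equality, rule assms)
  fix t assume "least L t (Upper L {x, y})"
  with assms have "t \<sqsubseteq> s" "s \<sqsubseteq> t" "s \<in> carrier L" "t \<in> carrier L"
    using least_closed[OF assms] by (simp_all add: least_def subset_iff)
  then show "t = s" by (simp add: le_antisym)
qed

lemma partial_order_inclusion: "partial_order (inclusion_order A)"
  by unfold_locales (auto simp: inclusion_order_def)

lemma partial_order_reverse_inclusion: "partial_order (reverse_inclusion_order A)"
  by unfold_locales (auto simp: reverse_inclusion_order_def)

lemma greatest_inclusion:
  assumes "x \<in> A" "y \<in> A"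
  shows "greatest (inclusion_order A) s (Lower (inclusion_order A) {x, y}) \<longleftrightarrow>
    s \<in> A \<and> s \<subseteq> x \<and> s \<subseteq> y \<and> (\<forall>z\<in>A. z \<subseteq> x \<longrightarrow> z \<subseteq> y \<longrightarrow> z \<subseteq> s)"
proof -
  have "Lower (inclusion_order A) {x, y} = {z \<in> A. z \<subseteq> x \<and> z \<subseteq> y}"
    using assms by (auto simp: Lower_def inclusion_order_def)
  then show ?thesis by (simp add: greatest_def inclusion_order_def) blast
qed

lemma least_inclusion:
  assumes "x \<in> A" "y \<in> A"
  shows "least (inclusion_order A) s (Upper (inclusion_order A) {x, y}) \<longleftrightarrow>
    s \<in> A \<and> x \<subseteq> s \<and> y \<subseteq> s \<and> (\<forall>z\<in>A. x \<subseteq> z \<longrightarrow> y \<subseteq> z \<longrightarrow> s \<subseteq> z)"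
proof -
  have "Upper (inclusion_order A) {x, y} = {z \<in> A. x \<subseteq> z \<and> y \<subseteq> z}"
    using assms by (auto simp: Upper_def inclusion_order_def)
  then show ?thesis by (simp add: least_def inclusion_order_def) blast
qed

lemma greatest_reverse_inclusion:
  assumes "x \<in> A" "y \<in> A"
  shows "greatest (reverse_inclusion_order A) s (Lower (reverse_inclusion_order A) {x, y}) \<longleftrightarrow>
    s \<in> A \<and> x \<subseteq> s \<and> y \<subseteq> s \<and> (\<forall>z\<in>A. x \<subseteq> z \<longrightarrow> y \<subseteq> z \<longrightarrow> s \<subseteq> z)"
proof -
  have "Lower (reverse_inclusion_order A) {x, y} = {z \<in> A. x \<subseteq> z \<and> y \<subseteq> z}"
    using assms by (auto simp: Lower_def reverse_inclusion_order_def)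
  then show ?thesis by (simp add: greatest_def reverse_inclusion_order_def) blast
qed

lemma least_reverse_inclusion:
  assumes "x \<in> A" "y \<in> A"
  shows "least (reverse_inclusion_order A) s (Upper (reverse_inclusion_order A) {x, y}) \<longleftrightarrow>
    s \<in> A \<and> s \<subseteq> x \<and> s \<subseteq> y \<and> (\<forall>z\<in>A. z \<subseteq> x \<longrightarrow> z \<subseteq> y \<longrightarrow> z \<subseteq> s)"
proof -
  have "Upper (reverse_inclusion_order A) {x, y} = {z \<in> A. z \<subseteq> x \<and> z \<subseteq> y}"
    using assms by (auto simp: Upper_def reverse_inclusion_order_def)
  then show ?thesis by (simp add: least_def reverse_inclusion_order_def) blast
qed

text \<open>With reverse inclusion on \<open>B\<close>, \<open>f\<close> is an order isomorphism.
  Meets in \<open>A\<close> are intersections and are carried over to \<open>B\<close>; joins are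
  left to \<open>lattice_iso\<close>, since two hyperbalanced flats may have no common upper
  bound.\<close>

locale order_reversing_bijection =
  fixes f :: "'a set \<Rightarrow> 'b set" and A :: "'a set set" and B :: "'b set set"
  assumes bij: "bij_betw f A B"
    and reversing: "x \<in> A \<Longrightarrow> y \<in> A \<Longrightarrow> x \<subseteq> y \<longleftrightarrow> f y \<subseteq> f x"
    and Int_closed: "x \<in> A \<Longrightarrow> y \<in> A \<Longrightarrow> x \<inter> y \<in> A"
begin

lemma B_image: "B = f ` A"
  using bij by (simp add: bij_betw_def)

lemma greatest_Int: "x \<in> A \<Longrightarrow> y \<in> A \<Longrightarrow>
  greatest (inclusion_order A) (x \<inter> y) (Lower (inclusion_order A) {x, y})"
  by (simp add: greatest_inclusion Int_closed)

lemma greatest_transfer: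
  assumes "x \<in> A" "y \<in> A"
    and "greatest (inclusion_order A) s (Lower (inclusion_order A) {x, y})"
  shows "greatest (reverse_inclusion_order B) (f s) (Lower (reverse_inclusion_order B) {f x, f y})"
proof -
  have s: "s \<in> A" "s \<subseteq> x" "s \<subseteq> y" "\<And>z. z \<in> A \<Longrightarrow> z \<subseteq> x \<Longrightarrow> z \<subseteq> y \<Longrightarrow> z \<subseteq> s"
    using assms(3) greatest_inclusion[OF assms(1,2)] by auto
  have "f x \<in> B" "f y \<in> B" "f s \<in> B" using assms(1,2) s(1) B_image by auto
  moreover have "f x \<subseteq> f s" "f y \<subseteq> f s" using reversing s(1-3) assms(1,2) by blast+
  moreover have "f s \<subseteq> w" if w: "w \<in> B" "f x \<subseteq> w" "f y \<subseteq> w" for w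
  proof -
    obtain z where z: "z \<in> A" "w = f z" using w(1) B_image by blast
    then have "z \<subseteq> s" using s(4) reversing assms(1,2) w(2,3) by blast
    then show ?thesis using reversing z s(1) by blast
  qed
  ultimately show ?thesis by (simp add: greatest_reverse_inclusion)
qed

lemma least_transfer:
  assumes "x \<in> A" "y \<in> A"
    and "least (inclusion_order A) s (Upper (inclusion_order A) {x, y})"
  shows "least (reverse_inclusion_order B) (f s) (Upper (reverse_inclusion_order B) {f x, f y})"
proof -
  have s: "s \<in> A" "x \<subseteq> s" "y \<subseteq> s" "\<And>z. z \<in> A \<Longrightarrow> x \<subseteq> z \<Longrightarrow> y \<subseteq> z \<Longrightarrow> s \<subseteq> z"
    using assms(3) least_inclusion[OF assms(1,2)] by auto
  have "f x \<in> B" "f y \<in> B" "f s \<in> B" using assms(1,2) s(1) B_image by auto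
  moreover have "f s \<subseteq> f x" "f s \<subseteq> f y" using reversing s(1-3) assms(1,2) by blast+
  moreover have "w \<subseteq> f s" if w: "w \<in> B" "w \<subseteq> f x" "w \<subseteq> f y" for w
  proof -
    obtain z where z: "z \<in> A" "w = f z" using w(1) B_image by blast
    then have "s \<subseteq> z" using s(4) reversing assms(1,2) w(2,3) by blast
    then show ?thesis using reversing z s(1) by blast
  qed
  ultimately show ?thesis by (simp add: least_reverse_inclusion)
qed

lemma lower_semilattices:
  "lower_semilattice (inclusion_order A)" "lower_semilattice (reverse_inclusion_order B)"
proof -
  show "lower_semilattice (inclusion_order A)"
    unfolding lower_semilattice_def lower_semilattice_axioms_def
    using partial_order_inclusion greatest_Int by (fastforce simp: inclusion_order_def)
  have "\<exists>s. greatest (reverse_inclusion_order B) s (Lower (reverse_inclusion_order B) {u, v})"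
    if "u \<in> B" "v \<in> B" for u v
    using that greatest_transfer[OF _ _ greatest_Int] unfolding B_image by blast
  then show "lower_semilattice (reverse_inclusion_order B)"
    unfolding lower_semilattice_def lower_semilattice_axioms_def
    using partial_order_reverse_inclusion by (simp add: reverse_inclusion_order_def)
qed

lemma meet_preserved:
  assumes "x \<in> A" "y \<in> A"
  shows "f (x \<sqinter>\<^bsub>inclusion_order A\<^esub> y) = f x \<sqinter>\<^bsub>reverse_inclusion_order B\<^esub> f y"
  using partial_order.meet_eqI[OF partial_order_inclusion greatest_Int[OF assms]]
    partial_order.meet_eqI[OF partial_order_reverse_inclusion
      greatest_transfer[OF assms greatest_Int[OF assms]]]
  by simp

lemma semilattice_iso: "semilattice_isomorphism (inclusion_order A) (reverse_inclusion_order B) f"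
  unfolding semilattice_isomorphism_def
  using lower_semilattices bij meet_preserved
  by (simp add: inclusion_order_def reverse_inclusion_order_def)

lemma lattice_iso:
  assumes sup: "\<And>x y. x \<in> A \<Longrightarrow> y \<in> A \<Longrightarrow>
    \<exists>s\<in>A. x \<subseteq> s \<and> y \<subseteq> s \<and> (\<forall>z\<in>A. x \<subseteq> z \<longrightarrow> y \<subseteq> z \<longrightarrow> s \<subseteq> z)"
  shows "lattice_isomorphism (inclusion_order A) (reverse_inclusion_order B) f"
proof -
  have least: "\<exists>s. least (inclusion_order A) s (Upper (inclusion_order A) {x, y})"
    if "x \<in> A" "y \<in> A" for x y
    using sup[OF that] least_inclusion[OF that] by blast
  then have "upper_semilattice (inclusion_order A)"
    unfolding upper_semilattice_def upper_semilattice_axioms_def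
    using partial_order_inclusion by (simp add: inclusion_order_def)
  then have 1: "lattice (inclusion_order A)"
    using lower_semilattices(1) by (simp add: lattice_def)
  have "\<exists>s. least (reverse_inclusion_order B) s (Upper (reverse_inclusion_order B) {u, v})"
    if uv: "u \<in> B" "v \<in> B" for u v
  proof -
    obtain x y where xy: "x \<in> A" "y \<in> A" "u = f x" "v = f y" using uv B_image by blast
    then show ?thesis using least[OF xy(1,2)] least_transfer[OF xy(1,2)] by blast
  qed
  then have "upper_semilattice (reverse_inclusion_order B)"
    unfolding upper_semilattice_def upper_semilattice_axioms_def
    using partial_order_reverse_inclusion by (simp add: reverse_inclusion_order_def)
  then have 2: "lattice (reverse_inclusion_order B)"
    using lower_semilattices(2) by (simp add: lattice_def)
  have "f (x \<squnion>\<^bsub>inclusion_order A\<^esub> y) = f x \<squnion>\<^bsub>reverse_inclusion_order B\<^esub> f y"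
    if xy: "x \<in> A" "y \<in> A" for x y
  proof -
    obtain s where s: "least (inclusion_order A) s (Upper (inclusion_order A) {x, y})"
      using least[OF xy] by blast
    show ?thesis
      using partial_order.join_eqI[OF partial_order_inclusion s]
        partial_order.join_eqI[OF partial_order_reverse_inclusion least_transfer[OF xy s]]
      by simp
  qed
  then show ?thesis
    unfolding lattice_isomorphism_def join_pres_def meet_pres_def
    using 1 2 bij meet_preserved by (simp add: inclusion_order_def reverse_inclusion_order_def)
qed

end

section \<open>Flats and intersections\<close>

text \<open>An isomorphism asserts the axioms on both sides; this supplies those of the
  arrangement.\<close>

lemma matroid_transfer:
  assumes M: "matroid M" and bij: "bij_betw f (ground M) (ground N)"
    and rk: "\<And>S. S \<subseteq> ground M \<Longrightarrow> rk N (f ` S) = rk M S"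
  shows "matroid N"
proof -
  have inj: "inj_on f (ground M)" and N: "ground N = f ` ground M"
    using bij by (auto simp: bij_betw_def)
  have m: "finite (ground M)" "\<And>S. S \<subseteq> ground M \<Longrightarrow> rk M S \<le> card S"
    "\<And>S T. S \<subseteq> T \<Longrightarrow> T \<subseteq> ground M \<Longrightarrow> rk M S \<le> rk M T"
    "\<And>S T. S \<subseteq> ground M \<Longrightarrow> T \<subseteq> ground M \<Longrightarrow> rk M (S \<union> T) + rk M (S \<inter> T) \<le> rk M S + rk M T"
    using M unfolding matroid_def by blast+
  show ?thesis unfolding matroid_def
  proof (intro conjI allI impI)
    show "finite (ground N)" using m(1) N by simp
    fix S' assume "S' \<subseteq> ground N"
    then obtain S where S: "S \<subseteq> ground M" "S' = f ` S" unfolding N by (auto simp: subset_image_iff)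
    show "rk N S' \<le> card S'"
      using m(2)[OF S(1)] rk[OF S(1)] card_image[OF inj_on_subset[OF inj S(1)]] S(2) by simp
    fix T' assume "T' \<subseteq> ground N"
    then obtain T where T: "T \<subseteq> ground M" "T' = f ` T" unfolding N by (auto simp: subset_image_iff)
    have "rk N (S' \<union> T') = rk M (S \<union> T)" "rk N (S' \<inter> T') = rk M (S \<inter> T)"
      using rk[of "S \<union> T"] rk[of "S \<inter> T"] S T inj_on_image_Int[OF inj S(1) T(1)]
      by (auto simp: image_Un)
    then show "rk N (S' \<union> T') + rk N (S' \<inter> T') \<le> rk N S' + rk N T'"
      using m(4)[OF S(1) T(1)] rk S T by simp
  next
    fix S' T' assume st: "S' \<subseteq> T'" "T' \<subseteq> ground N"
    then obtain T where T: "T \<subseteq> ground M" "T' = f ` T" unfolding N by (auto simp: subset_image_iff)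
    then obtain S where S: "S \<subseteq> T" "S' = f ` S" using st(1) by (auto simp: subset_image_iff)
    then show "rk N S' \<le> rk N T'" using m(3)[OF S(1) T(1)] rk[of S] rk[of T] S T by auto
  qed
qed

context gain_graph
begin

lemma sol_space_antimono: "S \<subseteq> T \<Longrightarrow> sol_space T \<subseteq> sol_space S"
  by (auto simp: sol_space_def)

lemma sol_space_Un: "sol_space (S \<union> T) = sol_space S \<inter> sol_space T"
  by (auto simp: sol_space_def)

lemma sol_space_insert: "sol_space (insert e S) = sol_space S \<inter> sol_space {e}"
  by (auto simp: sol_space_def)

text \<open>If the new equation is not implied, some old solution \<open>a\<close> violates it, and
  subtracting a suitable multiple of \<open>a\<close> makes any other old solution satisfy it. This
  bounds the rank by the cardinality.\<close>

lemma dim_sol_space_insert: "vec.dim (sol_space S) \<le> vec.dim (sol_space (insert e S)) + 1"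
proof (cases "sol_space S \<subseteq> sol_space {e}")
  case True
  then have "sol_space (insert e S) = sol_space S" using sol_space_insert by blast
  then show ?thesis by simp
next
  case False
  let ?q = "scalar_product (edge_vector G e)"
  obtain a where a: "a \<in> sol_space S" "?q a \<noteq> 0" using False by (auto simp: sol_space_def)
  have "sol_space S \<subseteq> vec.span (insert a (sol_space (insert e S)))"
  proof
    fix y assume y: "y \<in> sol_space S"
    define c where "c = ?q y / ?q a"
    have "?q (y - c *s a) = ?q y - c * ?q a"
      by (simp add: scalar_product_def algebra_simps sum_subtractf sum_distrib_left)
    then have "?q (y - c *s a) = 0" using a(2) by (simp add: c_def)
    moreover have "y - c *s a \<in> sol_space S"
      using a(1) y subspace_sol_space by (intro vec.subspace_diff vec.subspace_scale)
    ultimately have "y - c *s a \<in> sol_space (insert e S)" by (simp add: sol_space_def)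
    then have "y - c *s a \<in> vec.span (insert a (sol_space (insert e S)))"
      by (intro vec.span_base) simp
    moreover have "c *s a \<in> vec.span (insert a (sol_space (insert e S)))"
      by (intro vec.span_scale vec.span_base) simp
    ultimately show "y \<in> vec.span (insert a (sol_space (insert e S)))"
      by (rule vec.span_add[of "y - c *s a" _ "c *s a", simplified])
  qed
  from vec.dim_subset[OF this]
  have "vec.dim (sol_space S) \<le> vec.dim (insert a (sol_space (insert e S)))"
    by (simp only: vec.dim_span)
  also have "\<dots> \<le> vec.dim (sol_space (insert e S)) + 1" by (simp add: vec.dim_insert)
  finally show ?thesis .
qed

lemma matroid_gain_matroid: "matroid (gain_matroid G)"
proof -
  have E: "ground (gain_matroid G) = edges G" by (simp add: gain_matroid_def)
  have fin: "finite (edges G)" using wf by (simp add: gain_signed_graph_def)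
  let ?r = "rk (gain_matroid G)" and ?d = "\<lambda>S. vec.dim (sol_space S)"
  have r: "?r S + ?d S = CARD('v option)" if "S \<subseteq> edges G" for S by (rule rank_plus_dim[OF that])
  show ?thesis unfolding matroid_def E
  proof (intro conjI allI impI)
    show "finite (edges G)" by (rule fin)
    fix S assume S: "S \<subseteq> edges G"
    then have "finite S" using fin finite_subset by blast
    then show "?r S \<le> card S" using S
    proof (induction S rule: finite_induct)
      case empty
      have "sol_space {} = UNIV" by (simp add: sol_space_def)
      then have "vec.dim (sol_space {}) = CARD('v option)" by (simp only: vec_dim_card)
      then show ?case using r[of "{}"] by simp
    next
      case (insert e S)
      then have "?r S \<le> card S" "S \<subseteq> edges G" by simp_all
      then show ?case
        using r[of S] r[OF insert.prems] dim_sol_space_insert[of S e] insert.hyps by simp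
    qed
    fix T assume T: "T \<subseteq> edges G"
    \<comment> \<open>The inclusion may be strict, which is why submodularity is an inequality; the
      dimension formula for sum and intersection gives the rest.\<close>
    have "{x + y |x y. x \<in> sol_space S \<and> y \<in> sol_space T} \<subseteq> sol_space (S \<inter> T)"
      using sol_space_antimono[of "S \<inter> T" S] sol_space_antimono[of "S \<inter> T" T]
        vec.subspace_add[OF subspace_sol_space[of "S \<inter> T"]] by auto
    from vec.dim_subset[OF this] have "?d S + ?d T \<le> ?d (S \<inter> T) + ?d (S \<union> T)"
      using vec.dim_sums_Int[OF subspace_sol_space subspace_sol_space, of S T] sol_space_Un by simp
    moreover have "S \<union> T \<subseteq> edges G" "S \<inter> T \<subseteq> edges G" using S T by auto
    ultimately show "?r (S \<union> T) + ?r (S \<inter> T) \<le> ?r S + ?r T"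
      using r[OF S] r[OF T] r[of "S \<union> T"] r[of "S \<inter> T"] by linarith
  next
    fix S T assume ST: "S \<subseteq> T" "T \<subseteq> edges G"
    then have "?d T \<le> ?d S" by (intro vec.dim_subset sol_space_antimono)
    then show "?r S \<le> ?r T" using r[of S] r[of T] ST subset_trans[OF ST] by linarith
  qed
qed

text \<open>The rank grows precisely when the new equation cuts the solution space down, so flats
  are the sets closed under implied equations.\<close>

lemma flat_iff:
  "F \<in> flats (gain_matroid G) \<longleftrightarrow>
    F \<subseteq> edges G \<and> (\<forall>e\<in>edges G. sol_space F \<subseteq> sol_space {e} \<longrightarrow> e \<in> F)"
proof -
  have "rk (gain_matroid G) F < rk (gain_matroid G) (insert e F) \<longleftrightarrow> \<not> sol_space F \<subseteq> sol_space {e}"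
    if F: "F \<subseteq> edges G" and e: "e \<in> edges G" for e
  proof -
    have sub: "sol_space (insert e F) \<subseteq> sol_space F" by (rule sol_space_antimono) auto
    have "rk (gain_matroid G) F < rk (gain_matroid G) (insert e F) \<longleftrightarrow>
        vec.dim (sol_space (insert e F)) < vec.dim (sol_space F)"
      using rank_plus_dim[OF F] rank_plus_dim[of "insert e F"] F e by auto
    also have "\<dots> \<longleftrightarrow> sol_space (insert e F) \<noteq> sol_space F"
      using vec.subspace_dim_equal[OF subspace_sol_space subspace_sol_space sub] by force
    also have "\<dots> \<longleftrightarrow> \<not> sol_space F \<subseteq> sol_space {e}" using sol_space_insert[of e F] by blast
    finally show ?thesis .
  qed
  then show ?thesis by (auto simp: flats_def) (auto simp: gain_matroid_def)
qed

definition flat_closure :: "'e set \<Rightarrow> 'e set" where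
  "flat_closure S = {e \<in> edges G. sol_space S \<subseteq> sol_space {e}}"

lemma sol_space_closure: "S \<subseteq> edges G \<Longrightarrow> sol_space (flat_closure S) = sol_space S"
  by (auto simp: flat_closure_def sol_space_def)

lemma closure_superset: "S \<subseteq> edges G \<Longrightarrow> S \<subseteq> flat_closure S"
  by (auto simp: flat_closure_def sol_space_def)

lemma closure_flat: "S \<subseteq> edges G \<Longrightarrow> flat_closure S \<in> flats (gain_matroid G)"
  unfolding flat_iff sol_space_closure by (auto simp: flat_closure_def)

lemma flat_subset_iff:
  assumes "F \<subseteq> edges G" "F' \<in> flats (gain_matroid G)"
  shows "F \<subseteq> F' \<longleftrightarrow> sol_space F' \<subseteq> sol_space F"
proof
  assume sub: "sol_space F' \<subseteq> sol_space F"
  show "F \<subseteq> F'"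
  proof
    fix e assume e: "e \<in> F"
    then have "sol_space F' \<subseteq> sol_space {e}" using sub sol_space_antimono[of "{e}" F] by blast
    then show "e \<in> F'" using assms e unfolding flat_iff by blast
  qed
qed (rule sol_space_antimono)

lemma flat_Int:
  assumes "F \<in> flats (gain_matroid G)" "F' \<in> flats (gain_matroid G)"
  shows "F \<inter> F' \<in> flats (gain_matroid G)"
  using assms sol_space_antimono[of "F \<inter> F'" F] sol_space_antimono[of "F \<inter> F'" F']
  unfolding flat_iff by blast

text \<open>Common source of both lattice statements: \<open>Q\<close> is \<open>True\<close> in the
  projective case and nonemptiness of the intersection in the affine one. Any \<open>S\<close> can
  be replaced by its closure, which has the same solutions; monotonicity of \<open>Q\<close> keeps
  closures and intersections of flats in the family.\<close>

lemma flats_order_reversing: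
  assumes f: "\<And>X Y. X \<subseteq> edges G \<Longrightarrow> Y \<subseteq> edges G \<Longrightarrow> Q X \<Longrightarrow> Q Y \<Longrightarrow>
      f X \<subseteq> f Y \<longleftrightarrow> sol_space X \<subseteq> sol_space Y"
    and Q: "\<And>X Y. Q X \<Longrightarrow> sol_space X \<subseteq> sol_space Y \<Longrightarrow> Q Y"
  shows "order_reversing_bijection f {F \<in> flats (gain_matroid G). Q F} {f S |S. S \<subseteq> edges G \<and> Q S}"
proof
  show rev: "X \<subseteq> Y \<longleftrightarrow> f Y \<subseteq> f X"
    if "X \<in> {F \<in> flats (gain_matroid G). Q F}" "Y \<in> {F \<in> flats (gain_matroid G). Q F}" for X Y
    using that f[of Y X] flat_subset_iff[of X Y] by (auto simp: flat_iff)
  show "X \<inter> Y \<in> {F \<in> flats (gain_matroid G). Q F}"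
    if "X \<in> {F \<in> flats (gain_matroid G). Q F}" "Y \<in> {F \<in> flats (gain_matroid G). Q F}" for X Y
    using that flat_Int[of X Y] Q[of X "X \<inter> Y"] sol_space_antimono[of "X \<inter> Y" X] by auto
  show "bij_betw f {F \<in> flats (gain_matroid G). Q F} {f S |S. S \<subseteq> edges G \<and> Q S}"
    unfolding bij_betw_def
  proof (intro conjI equalityI subsetI)
    show "inj_on f {F \<in> flats (gain_matroid G). Q F}"
    proof (rule inj_onI)
      fix X Y assume XY: "X \<in> {F \<in> flats (gain_matroid G). Q F}"
        "Y \<in> {F \<in> flats (gain_matroid G). Q F}" "f X = f Y"
      then show "X = Y" using rev[OF XY(1,2)] rev[OF XY(2,1)] by simp
    qed
  next
    fix t assume "t \<in> f ` {F \<in> flats (gain_matroid G). Q F}"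
    then show "t \<in> {f S |S. S \<subseteq> edges G \<and> Q S}" by (auto simp: flat_iff)
  next
    fix t assume "t \<in> {f S |S. S \<subseteq> edges G \<and> Q S}"
    then obtain S where S: "S \<subseteq> edges G" "Q S" "t = f S" by blast
    have cl: "flat_closure S \<subseteq> edges G" by (auto simp: flat_closure_def)
    have "Q (flat_closure S)" using Q S sol_space_closure by blast
    moreover from this have "f (flat_closure S) = t"
      using f[OF cl S(1)] f[OF S(1) cl] S sol_space_closure[OF S(1)] by auto
    ultimately show "t \<in> f ` {F \<in> flats (gain_matroid G). Q F}" using closure_flat[OF S(1)] by blast
  qed
qed

section \<open>The affine arrangement\<close>

lemma affine_intersection:
  "(\<Inter>e\<in>S. affine_hyperplane G e) = {x. homogenize x \<in> sol_space S}"
  by (auto simp: affine_hyperplane_def sol_space_def)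

text \<open>Affine points show only the solutions with nonzero coordinate \<open>None\<close>. A
  solution at infinity is the difference of two of these once a point \<open>x\<^sub>0\<close>
  exists; for an empty intersection it would be invisible.\<close>

lemma affine_subset_iff:
  assumes "homogenize x\<^sub>0 \<in> sol_space X"
  shows "{x. homogenize x \<in> sol_space X} \<subseteq> {x. homogenize x \<in> sol_space Y} \<longleftrightarrow>
    sol_space X \<subseteq> sol_space Y"
proof
  assume sub: "{x. homogenize x \<in> sol_space X} \<subseteq> {x. homogenize x \<in> sol_space Y}"
  have finite_part: "y \<in> sol_space Y" if y: "y \<in> sol_space X" "y $ None \<noteq> 0" for y
  proof -
    let ?x = "\<chi> v. y $ Some v / y $ None"
    have eq: "y = y $ None *s homogenize ?x" by (rule scale_to_homogenize[OF y(2)])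
    have "homogenize ?x = inverse (y $ None) *s y"
      using y(2) by (subst (4) eq) (simp add: vector_smult_assoc)
    then have "homogenize ?x \<in> sol_space X"
      using vec.subspace_scale[OF subspace_sol_space y(1)] by simp
    then have "homogenize ?x \<in> sol_space Y" using sub by blast
    then show ?thesis
      using vec.subspace_scale[OF subspace_sol_space, of "homogenize ?x" Y "y $ None"] eq by simp
  qed
  show "sol_space X \<subseteq> sol_space Y"
  proof
    fix y assume y: "y \<in> sol_space X"
    show "y \<in> sol_space Y"
    proof (cases "y $ None = 0")
      case True
      have h: "homogenize x\<^sub>0 $ None = (1::'k)" by (simp add: homogenize_def)
      have "y + homogenize x\<^sub>0 \<in> sol_space Y"
        using finite_part[OF vec.subspace_add[OF subspace_sol_space y assms]] True h by simp
      moreover have "homogenize x\<^sub>0 \<in> sol_space Y" using sub assms by blast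
      ultimately have "y + homogenize x\<^sub>0 - homogenize x\<^sub>0 \<in> sol_space Y"
        by (rule vec.subspace_diff[OF subspace_sol_space])
      then show ?thesis by simp
    qed (use finite_part y in blast)
  qed
qed blast

lemma affine_semilattice_isomorphism:
  "semilattice_isomorphism (Lat_balanced G) (L_affine G) (\<lambda>X. \<Inter>e\<in>X. affine_hyperplane G e)"
proof -
  let ?f = "\<lambda>X. {x. homogenize x \<in> sol_space X}"
  let ?Q = "\<lambda>X. ?f X \<noteq> {}"
  interpret order_reversing_bijection ?f "{F \<in> flats (gain_matroid G). ?Q F}" "{?f S |S. S \<subseteq> edges G \<and> ?Q S}"
  proof (rule flats_order_reversing)
    show "?f X \<subseteq> ?f Y \<longleftrightarrow> sol_space X \<subseteq> sol_space Y" if "?Q X" for X Y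
      using that affine_subset_iff by blast
  qed blast
  \<comment> \<open>A nonempty affine intersection is a solvable set of equations, which links it to
    hyperbalance.\<close>
  have "{F \<in> flats (gain_matroid G). ?Q F} = {F \<in> flats (gain_matroid G). hyperbalanced G F}"
    using hyperbalanced_iff_solvable solvable_iff_homogenize by (auto simp: flat_iff)
  moreover have "{?f S |S. S \<subseteq> edges G \<and> ?Q S} = {t. t \<noteq> {} \<and> (\<exists>S\<subseteq>edges G. t = ?f S)}" by blast
  ultimately show ?thesis using semilattice_iso
    unfolding Lat_balanced_def L_affine_def affine_intersection by simp
qed

end

section \<open>The projective arrangement\<close>

lemma proj_point_subset_iff:
  fixes y :: "'k::field ^ 'm::finite"
  assumes "vec.subspace W"
  shows "proj_point y \<subseteq> W \<longleftrightarrow> y \<in> W"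
  using assms vec.span_minimal[of "{y}" W] vec.span_base[of y "{y}"] by (auto simp: proj_point_def)

lemma extend_simps:
  "edges (extend G) = insert None (Some ` edges G)"
  "ends (extend G) None = []" "ends (extend G) (Some e) = ends G e"
  "esign (extend G) None = 1" "esign (extend G) (Some e) = esign G e"
  "orient (extend G) (Some e) = orient G e"
  by (simp_all add: extend_def)

context gain_graph
begin

text \<open>This makes all preceding results available for \<open>extend G\<close>, where the added
  edge \<open>None\<close> contributes the equation \<open>y $ None = 0\<close>.\<close>

lemma gain_graph_extend: "gain_graph (extend G)"
  using wf char by unfold_locales (auto simp: gain_signed_graph_def extend_simps)

interpretation ext: gain_graph "extend G"
  by (rule gain_graph_extend)

text \<open>Solution spaces are linear, so membership of a point does not depend on the vector
  representing it.\<close>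

lemma proj_intersection_members:
  "proj_intersection (proj_member G ` X) = {proj_point y |y. y \<noteq> 0 \<and> y \<in> ext.sol_space X}"
proof -
  have h: "proj_point y \<in> proj_hyperplane (extend G) e \<longleftrightarrow> y \<in> ext.sol_space {e}"
    if y: "y \<noteq> 0" for y and e :: "'e option"
  proof
    assume "proj_point y \<in> proj_hyperplane (extend G) e"
    then obtain y' where "proj_point y = proj_point y'" "y' \<in> ext.sol_space {e}"
      by (auto simp: proj_hyperplane_def ext.sol_space_def)
    then show "y \<in> ext.sol_space {e}"
      using proj_point_subset_iff[OF ext.subspace_sol_space] by metis
  qed (use y in \<open>auto simp: proj_hyperplane_def ext.sol_space_def\<close>)
  have "y \<in> ext.sol_space X \<longleftrightarrow> (\<forall>e\<in>X. y \<in> ext.sol_space {e})" for y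
    by (auto simp: ext.sol_space_def)
  then show ?thesis
    using h by (auto simp: proj_intersection_def proj_space_def proj_member_def)
qed

lemma proj_subset_iff:
  "proj_intersection (proj_member G ` X) \<subseteq> proj_intersection (proj_member G ` Y) \<longleftrightarrow>
    ext.sol_space X \<subseteq> ext.sol_space Y"
proof
  assume sub: "proj_intersection (proj_member G ` X) \<subseteq> proj_intersection (proj_member G ` Y)"
  show "ext.sol_space X \<subseteq> ext.sol_space Y"
  proof
    fix y assume y: "y \<in> ext.sol_space X"
    show "y \<in> ext.sol_space Y"
    proof (cases "y = 0")
      case True
      then show ?thesis using vec.subspace_0[OF ext.subspace_sol_space] by simp
    next
      case False
      then have "proj_point y \<in> proj_intersection (proj_member G ` Y)"
        using sub y unfolding proj_intersection_members by blast
      then obtain y' where "proj_point y = proj_point y'" "y' \<in> ext.sol_space Y"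
        unfolding proj_intersection_members by blast
      then show ?thesis using proj_point_subset_iff[OF ext.subspace_sol_space] by metis
    qed
  qed
qed (auto simp: proj_intersection_members)

text \<open>The points of the intersection fill the solution space, except that their union is empty
  and lacks 0 when that space is zero. Inserting 0 does not change the dimension.\<close>

lemma proj_codim_intersection:
  assumes "X \<subseteq> edges (extend G)"
  shows "proj_codim (proj_intersection (proj_member G ` X)) = rk (extended_matroid G) X"
proof -
  let ?U = "\<Union>(proj_intersection (proj_member G ` X))"
  have "?U \<subseteq> ext.sol_space X"
    using proj_point_subset_iff[OF ext.subspace_sol_space] unfolding proj_intersection_members by blast
  moreover have "ext.sol_space X \<subseteq> insert 0 ?U"
  proof
    fix y assume y: "y \<in> ext.sol_space X"
    have "y \<in> proj_point y" by (simp add: proj_point_def vec.span_base)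
    then show "y \<in> insert 0 ?U" using y unfolding proj_intersection_members by blast
  qed
  ultimately have "vec.dim ?U \<le> vec.dim (ext.sol_space X)"
    "vec.dim (ext.sol_space X) \<le> vec.dim (insert 0 ?U)" by (auto intro: vec.dim_subset)
  then have "vec.dim ?U = vec.dim (ext.sol_space X)"
    by (simp add: vec.dim_insert vec.span_zero)
  then show ?thesis using ext.rank_plus_dim[OF assms]
    by (simp add: proj_codim_def extended_matroid_def)
qed

lemma inj_proj_member: "inj_on (proj_member G) X"
  by (auto simp: inj_on_def proj_member_def)

lemma projective_matroid_isomorphism:
  "matroid_isomorphism (extended_matroid G) (arrangement_matroid G) (proj_member G)"
proof -
  have M: "matroid (extended_matroid G)"
    unfolding extended_matroid_def by (rule ext.matroid_gain_matroid)
  have E: "ground (extended_matroid G) = edges (extend G)"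
    by (simp add: extended_matroid_def gain_matroid_def)
  have bij: "bij_betw (proj_member G) (ground (extended_matroid G)) (ground (arrangement_matroid G))"
    using inj_proj_member by (simp add: E bij_betw_def arrangement_matroid_def proj_arrangement_def)
  have rk: "rk (arrangement_matroid G) (proj_member G ` S) = rk (extended_matroid G) S"
    if "S \<subseteq> ground (extended_matroid G)" for S
    using proj_codim_intersection that by (simp add: E arrangement_matroid_def)
  show ?thesis unfolding matroid_isomorphism_def
    using M matroid_transfer[OF M bij rk] bij rk by blast
qed

lemma projective_lattice_isomorphism:
  "lattice_isomorphism (Lat_extended G) (L_projective G)
    (\<lambda>X. proj_intersection (proj_member G ` X))"
proof -
  let ?f = "\<lambda>X. proj_intersection (proj_member G ` X)"
  interpret order_reversing_bijection ?f "{F \<in> flats (gain_matroid (extend G)). True}"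
    "{?f S |S. S \<subseteq> edges (extend G) \<and> True}"
    by (rule ext.flats_order_reversing) (simp_all add: proj_subset_iff)
  have "{?f S |S. S \<subseteq> edges (extend G) \<and> True} =
      {proj_intersection F |F. F \<subseteq> proj_arrangement G}"
    unfolding proj_arrangement_def by (auto simp: subset_image_iff)
  moreover have "lattice_isomorphism (inclusion_order {F \<in> flats (gain_matroid (extend G)). True})
      (reverse_inclusion_order {?f S |S. S \<subseteq> edges (extend G) \<and> True}) ?f"
  proof (rule lattice_iso)
    fix x y assume "x \<in> {F \<in> flats (gain_matroid (extend G)). True}"
      "y \<in> {F \<in> flats (gain_matroid (extend G)). True}"
    then have sub: "x \<union> y \<subseteq> edges (extend G)" by (auto simp: ext.flat_iff)
    \<comment> \<open>The closure of the union is the join of two flats.\<close>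
    have "ext.flat_closure (x \<union> y) \<subseteq> z"
      if "z \<in> flats (gain_matroid (extend G))" "x \<union> y \<subseteq> z" for z
      using ext.flat_subset_iff[OF _ that(1)] ext.sol_space_closure[OF sub] that sub
        ext.sol_space_antimono[OF that(2)] by (auto simp: ext.flat_closure_def)
    then show "\<exists>s\<in>{F \<in> flats (gain_matroid (extend G)). True}. x \<subseteq> s \<and> y \<subseteq> s \<and>
        (\<forall>z\<in>{F \<in> flats (gain_matroid (extend G)). True}. x \<subseteq> z \<longrightarrow> y \<subseteq> z \<longrightarrow> s \<subseteq> z)"
      using ext.closure_flat[OF sub] ext.closure_superset[OF sub]
      by (intro bexI[of _ "ext.flat_closure (x \<union> y)"]) auto
  qed
  ultimately show ?thesis unfolding Lat_extended_def L_projective_def extended_matroid_def by simp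
qed

end

theorem theorem10p1:
  fixes G :: "('v::finite, 'e, 'k::field) gsgraph"
  assumes "gain_signed_graph G"
    and "CHAR('k) \<noteq> 2"
  shows "matroid_isomorphism (extended_matroid G) (arrangement_matroid G) (proj_member G)
    \<and> lattice_isomorphism (Lat_extended G) (L_projective G)
        (\<lambda>X. proj_intersection (proj_member G ` X))
    \<and> semilattice_isomorphism (Lat_balanced G) (L_affine G)
        (\<lambda>X. \<Inter>e\<in>X. affine_hyperplane G e)"
proof -
  have "(2::'k) \<noteq> 0"
  proof
    assume "(2::'k) = 0"
    \<comment> \<open>A characteristic dividing 2 is 1 or 2, and a field does not have
      characteristic 1.\<close>
    then have "CHAR('k) dvd 2" using of_nat_eq_0_iff_char_dvd[of 2, where 'a = 'k] by simp
    then have "CHAR('k) \<in> {1, 2}" using dvd_imp_le[of "CHAR('k)" 2] by (auto simp: le_Suc_eq numeral_2_eq_2)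
    then show False using assms(2) CHAR_not_1'[where 'a = 'k] by auto
  qed
  then interpret gain_graph G using assms(1) by unfold_locales
  show ?thesis
    using projective_matroid_isomorphism projective_lattice_isomorphism
      affine_semilattice_isomorphism by blast
qed

end
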